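(* Let $\rho$ be a bipartite state on a finite-dimensional space $A\otimes B$ and let $P_{AB}$ be the orthogonal projection onto the support of $\rho$. If there is a Hermitian operator $Y$ on $A\otimes B$ such that $Y\pm P_{AB}^{T_B}\ge0$ and $$\|\rho^{T_B}\|_1<\|Y^{T_B}\|_\infty^{-1},$$ then $E_D(\rho)<E_C(\rho)$, where $E_D$ and $E_C$ are the distillable entanglement and the entanglement cost under PPT operations.
   Context: All Hilbert spaces are finite-dimensional. A state is a positive semidefinite operator of trace one. $T_B$ denotes partial transpose on Bob's system: $(|i_Aj_B\rangle\langle k_Al_B|)^{T_B}=|i_Al_B\rangle\langle k_Aj_B|$. For tensor powers, the bipartition is all of Alice's systems versus all of Bob's systems. $\|\cdot\|_1$ is the trace norm and $\|\cdot\|_\infty$ the operator norm. PPT operations: a CPTP map $\Lambda:\mathcal{L}(A\otimes B)\to\mathcal{L}(A'\otimes B')$ is a PPT operation if $T_{B'}\circ\Lambda\circ T_B$ is completely positive. Let $\Phi=|\phi\rangle\langle\phi|$, $|\phi\rangle=\frac1{\sqrt2}(|00\rangle+|11\rangle)$. Then $$E_D(\rho)=\sup\Big\{r\ge0:\lim_{n\to\infty}\inf_{\Lambda\text{ PPT operation}}\|\Lambda(\rho^{\otimes n})-\Phi^{\otimes\lfloor rn\rfloor}\|_1=0\Big\},$$ $$E_C(\rho)=\inf\Big\{r\ge0:\lim_{n\to\infty}\inf_{\Lambda\text{ PPT operation}}\|\rho^{\otimes n}-\Lambda(\Phi^{\otimes\lfloor rn\rfloor})\|_1=0\Big\}.$$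 *)

theory Defs
  imports
    "Jordan_Normal_Form.Schur_Decomposition"
    "Jordan_Normal_Form.Matrix_Kernel"
    "HOL-Library.Extended_Real"
begin

text \<open>
  A Hilbert space of dimension \<open>d\<close> is \<open>\<complex>\<^sup>d\<close>, i.e. \<open>carrier_vec d\<close>, with inner product
  \<open>\<bullet>c\<close> (antilinear in the second argument).
  The order on \<^typ>\<open>complex\<close> is the one of \<open>HOL-Library.Complex_Order\<close>:
  \<open>0 \<le> z\<close> means that \<open>z\<close> is real and nonnegative.
\<close>

section \<open>Operators\<close>

definition hermitian :: "complex mat \<Rightarrow> bool" where
  "hermitian X \<longleftrightarrow> mat_adjoint X = X"

definition psd :: "nat \<Rightarrow> complex mat \<Rightarrow> bool" where
  "psd d X \<longleftrightarrow> X \<in> carrier_mat d d \<and> (\<forall>v \<in> carrier_vec d. 0 \<le> (X *\<^sub>v v) \<bullet>c v)"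

definition tr :: "complex mat \<Rightarrow> complex" where
  "tr X = (\<Sum>i<dim_row X. X $$ (i, i))"

definition state :: "nat \<Rightarrow> complex mat \<Rightarrow> bool" where
  "state d \<rho> \<longleftrightarrow> psd d \<rho> \<and> tr \<rho> = 1"

definition norm_vec :: "complex vec \<Rightarrow> real" where
  "norm_vec v = sqrt (Re (v \<bullet>c v))"

definition op_norm :: "complex mat \<Rightarrow> real" where
  "op_norm X = Sup {norm_vec (X *\<^sub>v v) | v. v \<in> carrier_vec (dim_col X) \<and> norm_vec v \<le> 1}"

text \<open>A positive semidefinite matrix has exactly one positive semidefinite square root.\<close>

definition psd_sqrt :: "complex mat \<Rightarrow> complex mat" where
  "psd_sqrt X = (THE S. psd (dim_row X) S \<and> S * S = X)"

definition trace_norm :: "complex mat \<Rightarrow> real" where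
  "trace_norm X = Re (tr (psd_sqrt (mat_adjoint X * X)))"

definition supp :: "complex mat \<Rightarrow> complex vec set" where
  "supp X = {v \<in> carrier_vec (dim_col X). \<forall>w \<in> mat_kernel X. v \<bullet>c w = 0}"

definition orthogonal_projection_onto :: "nat \<Rightarrow> complex vec set \<Rightarrow> complex mat \<Rightarrow> bool" where
  "orthogonal_projection_onto d V P \<longleftrightarrow>
     P \<in> carrier_mat d d \<and> hermitian P \<and> P * P = P \<and> (\<lambda>v. P *\<^sub>v v) ` carrier_vec d = V"


section \<open>Bipartite systems\<close>

text \<open>
  For \<open>dim A = dA\<close> and \<open>dim B = dB\<close>, the product basis vector \<open>|i\<^sub>A j\<^sub>B\<rangle>\<close>
  of \<open>A \<otimes> B\<close> has index \<open>i * dB + j\<close> in \<open>\<complex>\<^bsup>dA * dB\<^esup>\<close>.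
\<close>

definition bip_mat ::
  "nat \<Rightarrow> nat \<Rightarrow> (nat \<Rightarrow> nat \<Rightarrow> nat \<Rightarrow> nat \<Rightarrow> complex) \<Rightarrow> complex mat" where
  "bip_mat dA dB f = mat (dA * dB) (dA * dB)
     (\<lambda>(r, c). f (r div dB) (r mod dB) (c div dB) (c mod dB))"

text \<open>The matrix entry \<open>\<langle>i\<^sub>A j\<^sub>B| X |k\<^sub>A l\<^sub>B\<rangle>\<close>:\<close>

definition bip_entry :: "nat \<Rightarrow> complex mat \<Rightarrow> nat \<Rightarrow> nat \<Rightarrow> nat \<Rightarrow> nat \<Rightarrow> complex" where
  "bip_entry dB X i j k l = X $$ (i * dB + j, k * dB + l)"

definition partial_transpose :: "nat \<Rightarrow> nat \<Rightarrow> complex mat \<Rightarrow> complex mat" where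
  "partial_transpose dA dB X = bip_mat dA dB (\<lambda>i j k l. bip_entry dB X i l k j)"

text \<open>
  The tensor product of operators on \<open>A \<otimes> B\<close> and \<open>A' \<otimes> B'\<close>, with the factors regrouped so that the
  result acts on \<open>(A \<otimes> A') \<otimes> (B \<otimes> B')\<close>. The basis vector \<open>|i\<^sub>A i'\<^sub>A'\<rangle>\<close> of \<open>A \<otimes> A'\<close> has index
  \<open>i * dA' + i'\<close>, and likewise for \<open>B \<otimes> B'\<close>.
\<close>

definition bip_tensor ::
  "nat \<Rightarrow> nat \<Rightarrow> complex mat \<Rightarrow> nat \<Rightarrow> nat \<Rightarrow> complex mat \<Rightarrow> complex mat" where
  "bip_tensor dA dB X dA' dB' X' = bip_mat (dA * dA') (dB * dB')
     (\<lambda>i j k l. bip_entry dB X (i div dA') (j div dB') (k div dA') (l div dB') *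
                bip_entry dB' X' (i mod dA') (j mod dB') (k mod dA') (l mod dB'))"

text \<open>
  The tensor power of an operator on \<open>A \<otimes> B\<close>, as an operator on
  \<open>A\<^sup>\<otimes>\<^sup>n \<otimes> B\<^sup>\<otimes>\<^sup>n\<close>, i.e. with local dimensions \<open>dA ^ n\<close> and \<open>dB ^ n\<close>.
\<close>

primrec bip_power :: "nat \<Rightarrow> nat \<Rightarrow> complex mat \<Rightarrow> nat \<Rightarrow> complex mat" where
  "bip_power dA dB X 0 = 1\<^sub>m 1"
| "bip_power dA dB X (Suc n) = bip_tensor dA dB X (dA ^ n) (dB ^ n) (bip_power dA dB X n)"

definition phi_vec :: "complex vec" where
  "phi_vec = complex_of_real (1 / sqrt 2) \<cdot>\<^sub>v (unit_vec 4 (0 * 2 + 0) + unit_vec 4 (1 * 2 + 1))"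

definition Phi :: "complex mat" where
  "Phi = mat 4 4 (\<lambda>(r, c). phi_vec $ r * cnj (phi_vec $ c))"


section \<open>PPT operations\<close>

text \<open>
  Maps between operator spaces are HOL functions on \<^typ>\<open>complex mat\<close>; only their values on
  \<open>carrier_mat d d\<close> matter.
\<close>

definition linear_map :: "nat \<Rightarrow> nat \<Rightarrow> (complex mat \<Rightarrow> complex mat) \<Rightarrow> bool" where
  "linear_map d d' \<Lambda> \<longleftrightarrow>
     (\<forall>X \<in> carrier_mat d d. \<Lambda> X \<in> carrier_mat d' d') \<and>
     (\<forall>X \<in> carrier_mat d d. \<forall>Y \<in> carrier_mat d d. \<Lambda> (X + Y) = \<Lambda> X + \<Lambda> Y) \<and>
     (\<forall>a. \<forall>X \<in> carrier_mat d d. \<Lambda> (a \<cdot>\<^sub>m X) = a \<cdot>\<^sub>m \<Lambda> X)"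

text \<open>
  The map \<open>id \<otimes> \<Lambda>\<close> on operators on \<open>\<complex>\<^sup>k \<otimes> \<complex>\<^sup>d\<close>:
  \<open>\<Lambda>\<close> is applied to each \<open>d \<times> d\<close> block \<open>\<langle>p| X |q\<rangle>\<close>, where \<open>p, q < k\<close>.
\<close>

definition ampliation ::
  "nat \<Rightarrow> nat \<Rightarrow> nat \<Rightarrow> (complex mat \<Rightarrow> complex mat) \<Rightarrow> complex mat \<Rightarrow> complex mat" where
  "ampliation k d d' \<Lambda> X = bip_mat k d'
     (\<lambda>p i q j. \<Lambda> (mat d d (\<lambda>(r, c). bip_entry d X p r q c)) $$ (i, j))"

definition completely_positive :: "nat \<Rightarrow> nat \<Rightarrow> (complex mat \<Rightarrow> complex mat) \<Rightarrow> bool" where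
  "completely_positive d d' \<Lambda> \<longleftrightarrow> linear_map d d' \<Lambda> \<and>
     (\<forall>k X. psd (k * d) X \<longrightarrow> psd (k * d') (ampliation k d d' \<Lambda> X))"

definition cptp :: "nat \<Rightarrow> nat \<Rightarrow> (complex mat \<Rightarrow> complex mat) \<Rightarrow> bool" where
  "cptp d d' \<Lambda> \<longleftrightarrow> completely_positive d d' \<Lambda> \<and> (\<forall>X \<in> carrier_mat d d. tr (\<Lambda> X) = tr X)"

definition ppt_operation ::
  "nat \<Rightarrow> nat \<Rightarrow> nat \<Rightarrow> nat \<Rightarrow> (complex mat \<Rightarrow> complex mat) \<Rightarrow> bool" where
  "ppt_operation dA dB dA' dB' \<Lambda> \<longleftrightarrow>
     cptp (dA * dB) (dA' * dB') \<Lambda> \<and>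
     completely_positive (dA * dB) (dA' * dB')
       (partial_transpose dA' dB' \<circ> \<Lambda> \<circ> partial_transpose dA dB)"


section \<open>Distillable entanglement and entanglement cost\<close>

text \<open>
  Suprema and infima of sets of rates are taken in the extended reals, so that an infimum over an
  empty set of rates would be \<open>\<infinity>\<close>. The infimum over PPT operations is a real one: for nonzero
  dimensions the set is nonempty (discard the input and prepare a product state) and the trace norm
  is bounded below by \<open>0\<close>.
\<close>

definition distillation_error :: "nat \<Rightarrow> nat \<Rightarrow> complex mat \<Rightarrow> nat \<Rightarrow> nat \<Rightarrow> real" where
  "distillation_error dA dB \<rho> n m =
     (INF \<Lambda> \<in> {\<Lambda>. ppt_operation (dA ^ n) (dB ^ n) (2 ^ m) (2 ^ m) \<Lambda>}.
        trace_norm (\<Lambda> (bip_power dA dB \<rho> n) - bip_power 2 2 Phi m))"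

definition dilution_error :: "nat \<Rightarrow> nat \<Rightarrow> complex mat \<Rightarrow> nat \<Rightarrow> nat \<Rightarrow> real" where
  "dilution_error dA dB \<rho> n m =
     (INF \<Lambda> \<in> {\<Lambda>. ppt_operation (2 ^ m) (2 ^ m) (dA ^ n) (dB ^ n) \<Lambda>}.
        trace_norm (bip_power dA dB \<rho> n - \<Lambda> (bip_power 2 2 Phi m)))"

definition distillable_entanglement :: "nat \<Rightarrow> nat \<Rightarrow> complex mat \<Rightarrow> ereal" where
  "distillable_entanglement dA dB \<rho> = Sup (ereal ` {r. 0 \<le> r \<and>
     (\<lambda>n. distillation_error dA dB \<rho> n (nat \<lfloor>r * real n\<rfloor>)) \<longlonglongrightarrow> 0})"

definition entanglement_cost :: "nat \<Rightarrow> nat \<Rightarrow> complex mat \<Rightarrow> ereal" where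
  "entanglement_cost dA dB \<rho> = Inf (ereal ` {r. 0 \<le> r \<and>
     (\<lambda>n. dilution_error dA dB \<rho> n (nat \<lfloor>r * real n\<rfloor>)) \<longlonglongrightarrow> 0})"

end

(*
Write S >= +-H for "S + H and S - H are positive semidefinite". If S >= +-H and T >= +-K, then
|tr (H K)| <= tr (S T), and the relation is preserved by tensor products and by positive maps.
So only single-copy inequalities are needed: |rho^TB| >= +-rho^TB, Y >= +-P^TB,
||Y^TB|| 1 >= +-Y^TB and 1/2 >= +-Phi^TB (Phi^TB is half the swap).

Let Lambda be a PPT operation and N the positive trace-preserving map T Lambda T.
Distillation: pairing N(|rho^TB|^n) with 2^-m 1 bounds the overlap of Lambda(rho^n) with Phi^m by
2^-m ||rho^TB||_1^n. Dilution: pairing N(2^-m 1) with Y^n, then undoing the partial transpose,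
bounds the weight of Lambda(Phi^m) on the support of rho^n by 2^m ||Y^TB||^n. A vanishing error
forces both bounds to be at least 1 in the limit, hence E_D <= log ||rho^TB||_1 < -log ||Y^TB|| <= E_C.
*)
theory Submission
  imports Defs "Jordan_Normal_Form.Spectral_Radius"
begin

section \<open>Adjoints and positive semidefinite matrices\<close>

text \<open>The relation S >= +-H replaces norm inequalities because it passes to tensor powers one
  factor at a time; multiplicativity of the trace norm and of the operator norm would instead
  require the spectra of tensor powers. Partial transposition T does not preserve positivity, so no
  estimate is carried through T alone. The first pairing is made where the positive map T \<Lambda>
  T acts, and T is then moved by identities only: it is an involution, it preserves the trace
  pairing of two matrices, and it fixes multiples of the identity. Each bound thereby collapses to a
  trace. In distillation the identity stands on the output side and trace preservation evaluates the
  bound; in dilution it stands on the input side, where 2^-m 1 has trace 2^m because the space has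
  dimension 4^m. Undoing T there is what lets the norm of Y^TB enter: the remaining operator is
  \<Lambda> of a positive matrix and can be paired a second time. The rate bounds are weak
  inequalities; strictness comes from the hypothesis alone.\<close>

lemma mat_adjoint_carrier [simp, intro]:
  "A \<in> carrier_mat n m \<Longrightarrow> mat_adjoint A \<in> carrier_mat m n"
  unfolding mat_adjoint_def by (auto simp: mat_of_rows_def)

lemma mat_adjoint_dim [simp]:
  "dim_row (mat_adjoint A) = dim_col A" "dim_col (mat_adjoint A) = dim_row A"
  unfolding mat_adjoint_def by (auto simp: mat_of_rows_def)

lemma mat_adjoint_index [simp]:
  fixes A :: "complex mat"
  shows "i < dim_col A \<Longrightarrow> j < dim_row A \<Longrightarrow> mat_adjoint A $$ (i, j) = cnj (A $$ (j, i))"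
  unfolding mat_adjoint_def by (auto simp: mat_of_rows_index)

lemma mat_mult_index:
  "A \<in> carrier_mat n m \<Longrightarrow> B \<in> carrier_mat m l \<Longrightarrow> i < n \<Longrightarrow> j < l \<Longrightarrow>
    (A * B) $$ (i, j) = (\<Sum>k<m. A $$ (i, k) * B $$ (k, j))"
  by (auto simp: scalar_prod_def atLeast0LessThan)

lemma mult_mat_unit_vec_index:
  fixes A :: "complex mat"
  assumes "A \<in> carrier_mat n m" "i < n" "j < m"
  shows "(A *\<^sub>v unit_vec m j) $ i = A $$ (i, j)"
  using assms scalar_prod_right_unit[of j m "row A i"] by auto

lemma mat_adjoint_adjoint [simp]:
  fixes A :: "complex mat"
  shows "mat_adjoint (mat_adjoint A) = A"
  by (rule eq_matI) auto

lemma mat_adjoint_mult: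
  fixes A :: "complex mat"
  assumes "A \<in> carrier_mat n m" "B \<in> carrier_mat m l"
  shows "mat_adjoint (A * B) = mat_adjoint B * mat_adjoint A"
proof (rule eq_matI)
  fix i j assume "i < dim_row (mat_adjoint B * mat_adjoint A)" "j < dim_col (mat_adjoint B * mat_adjoint A)"
  then have ij: "i < l" "j < n" using assms by auto
  have "mat_adjoint (A * B) $$ (i, j) = cnj (\<Sum>k<m. A $$ (j, k) * B $$ (k, i))"
    using assms ij by (simp add: mat_mult_index[OF assms] del: index_mult_mat(1))
  also have "\<dots> = (\<Sum>k<m. mat_adjoint B $$ (i, k) * mat_adjoint A $$ (k, j))"
    using assms ij by (auto simp: mult.commute intro!: sum.cong)
  also have "\<dots> = (mat_adjoint B * mat_adjoint A) $$ (i, j)"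
    using assms ij by (subst mat_mult_index[of _ l m _ n]) auto
  finally show "mat_adjoint (A * B) $$ (i, j) = (mat_adjoint B * mat_adjoint A) $$ (i, j)" .
qed (use assms in auto)

lemma mat_adjoint_add:
  fixes A :: "complex mat"
  assumes "A \<in> carrier_mat n m" "B \<in> carrier_mat n m"
  shows "mat_adjoint (A + B) = mat_adjoint A + mat_adjoint B"
  using assms by (intro eq_matI) auto

lemma mat_adjoint_minus:
  fixes A :: "complex mat"
  assumes "A \<in> carrier_mat n m" "B \<in> carrier_mat n m"
  shows "mat_adjoint (A - B) = mat_adjoint A - mat_adjoint B"
  using assms by (intro eq_matI) auto

lemma mat_adjoint_one [simp]: "mat_adjoint (1\<^sub>m n :: complex mat) = 1\<^sub>m n"
  by (intro eq_matI) auto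

lemma hermitian_add:
  "A \<in> carrier_mat n n \<Longrightarrow> B \<in> carrier_mat n n \<Longrightarrow> hermitian A \<Longrightarrow> hermitian B \<Longrightarrow> hermitian (A + B)"
  unfolding hermitian_def by (simp add: mat_adjoint_add)

lemma hermitian_minus:
  "A \<in> carrier_mat n n \<Longrightarrow> B \<in> carrier_mat n n \<Longrightarrow> hermitian A \<Longrightarrow> hermitian B \<Longrightarrow> hermitian (A - B)"
  unfolding hermitian_def by (simp add: mat_adjoint_minus)

lemma hermitian_index:
  assumes "hermitian A" "A \<in> carrier_mat n n" "i < n" "j < n"
  shows "A $$ (i, j) = cnj (A $$ (j, i))"
proof -
  have "mat_adjoint A $$ (i, j) = cnj (A $$ (j, i))" using assms by auto
  then show ?thesis using assms(1) unfolding hermitian_def by simp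
qed

section \<open>Inner products and Hermitian forms\<close>

lemma cscalar_prod_sum:
  "w \<in> carrier_vec n \<Longrightarrow> (v :: complex vec) \<bullet>c w = (\<Sum>i<n. v $ i * cnj (w $ i))"
  unfolding scalar_prod_def by (auto simp: atLeast0LessThan)

lemma cscalar_prod_self:
  "v \<in> carrier_vec n \<Longrightarrow> (v :: complex vec) \<bullet>c v = complex_of_real (\<Sum>i<n. (cmod (v $ i))\<^sup>2)"
  by (simp add: cscalar_prod_sum complex_mult_cnj cmod_def)

lemma cscalar_prod_adjoint:
  fixes A :: "complex mat"
  assumes "A \<in> carrier_mat n m" "v \<in> carrier_vec m" "w \<in> carrier_vec n"
  shows "(A *\<^sub>v v) \<bullet>c w = v \<bullet>c (mat_adjoint A *\<^sub>v w)"
proof -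
  have "(A *\<^sub>v v) \<bullet>c w = (\<Sum>i<n. (\<Sum>k<m. A $$ (i, k) * v $ k) * cnj (w $ i))"
    using assms by (subst cscalar_prod_sum) (auto simp: scalar_prod_def atLeast0LessThan intro!: sum.cong)
  also have "\<dots> = (\<Sum>k<m. \<Sum>i<n. A $$ (i, k) * v $ k * cnj (w $ i))"
    by (subst sum.swap) (simp add: sum_distrib_right)
  also have "\<dots> = (\<Sum>k<m. v $ k * cnj (\<Sum>i<n. mat_adjoint A $$ (k, i) * w $ i))"
    using assms by (auto simp: sum_distrib_left mult_ac intro!: sum.cong)
  also have "\<dots> = v \<bullet>c (mat_adjoint A *\<^sub>v w)"
    using assms mult_mat_vec_carrier[of "mat_adjoint A" m n w]
    by (subst cscalar_prod_sum[of _ m]) (auto simp: scalar_prod_def atLeast0LessThan intro!: sum.cong)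
  finally show ?thesis .
qed

lemma cscalar_prod_commute:
  fixes v w :: "complex vec"
  assumes "v \<in> carrier_vec n" "w \<in> carrier_vec n"
  shows "v \<bullet>c w = cnj (w \<bullet>c v)"
  using assms by (simp add: cscalar_prod_sum mult.commute)

lemma hermitian_form_real:
  assumes "hermitian A" "A \<in> carrier_mat n n" "v \<in> carrier_vec n"
  shows "Im ((A *\<^sub>v v) \<bullet>c v) = 0"
proof -
  have "(A *\<^sub>v v) \<bullet>c v = cnj ((A *\<^sub>v v) \<bullet>c v)"
    using assms cscalar_prod_adjoint[of A n n v v] cscalar_prod_commute[of v n "A *\<^sub>v v"]
    unfolding hermitian_def by auto
  then show ?thesis by (metis complex_cnj complex.sel(2) neg_equal_zero complex.collapse)
qed

section \<open>Positive semidefinite matrices\<close>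

lemma psd_carrier: "psd d X \<Longrightarrow> X \<in> carrier_mat d d"
  unfolding psd_def by simp

text \<open>Two basis vectors suffice to read entries off a quadratic form: \<open>b = 0\<close>
  isolates a diagonal entry, while \<open>b = 1\<close> and \<open>b = \<i>\<close> together compare
  the two entries of an off-diagonal pair.\<close>

lemma form_unit_vecs:
  fixes A :: "complex mat"
  assumes "A \<in> carrier_mat n n" "i < n" "j < n"
  shows "(A *\<^sub>v (unit_vec n i + b \<cdot>\<^sub>v unit_vec n j)) \<bullet>c (unit_vec n i + b \<cdot>\<^sub>v unit_vec n j)
    = A $$ (i, i) + b * A $$ (i, j) + cnj b * A $$ (j, i) + b * cnj b * A $$ (j, j)"
proof -
  let ?u = "unit_vec n i + b \<cdot>\<^sub>v unit_vec n j"
  have row: "(A *\<^sub>v ?u) $ k = A $$ (k, i) + b * A $$ (k, j)" if "k < n" for k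
  proof -
    have "(A *\<^sub>v ?u) $ k = (\<Sum>l<n. A $$ (k, l) * ((if l = i then 1 else 0) + b * (if l = j then 1 else 0)))"
      using assms that by (auto simp: scalar_prod_def atLeast0LessThan unit_vec_def algebra_simps intro!: sum.cong)
    also have "\<dots> = (\<Sum>l<n. (if l = i then A $$ (k, i) else 0)) + (\<Sum>l<n. (if l = j then b * A $$ (k, j) else 0))"
      unfolding sum.distrib[symmetric] by (intro sum.cong) (auto simp: algebra_simps)
    finally show ?thesis using assms by simp
  qed
  have "(A *\<^sub>v ?u) \<bullet>c ?u = (\<Sum>k<n. (A $$ (k, i) + b * A $$ (k, j)) *
      ((if k = i then 1 else 0) + cnj b * (if k = j then 1 else 0)))"
  proof -
    have "(A *\<^sub>v ?u) \<bullet>c ?u = (\<Sum>k<n. (A *\<^sub>v ?u) $ k * cnj (?u $ k))"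
      by (rule cscalar_prod_sum) simp
    also have "\<dots> = (\<Sum>k<n. (A $$ (k, i) + b * A $$ (k, j)) * cnj (?u $ k))" using row by simp
    finally show ?thesis using assms by (simp add: unit_vec_def if_distrib[of cnj] cong: if_cong)
  qed
  also have "\<dots> = (\<Sum>k<n. (if k = i then A $$ (i, i) + b * A $$ (i, j) else 0)) +
      (\<Sum>k<n. (if k = j then cnj b * (A $$ (j, i) + b * A $$ (j, j)) else 0))"
    unfolding sum.distrib[symmetric] by (intro sum.cong) (auto simp: algebra_simps)
  finally show ?thesis using assms by (simp add: algebra_simps)
qed

text \<open>Polarization over the complex numbers: a form with only real values comes from a
  Hermitian matrix, so hermiticity need not be part of \<open>psd\<close>.\<close>

lemma psd_hermitian:
  assumes "psd n A"
  shows "hermitian A"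
  unfolding hermitian_def
proof (rule eq_matI)
  have A: "A \<in> carrier_mat n n" and pos: "\<And>v. v \<in> carrier_vec n \<Longrightarrow> 0 \<le> (A *\<^sub>v v) \<bullet>c v"
    using assms unfolding psd_def by auto
  fix i j assume "i < dim_row A" "j < dim_col A"
  then have ij: "i < n" "j < n" using A by auto
  have im: "Im (A $$ (i, i) + b * A $$ (i, j) + cnj b * A $$ (j, i) + b * cnj b * A $$ (j, j)) = 0"
    if "i < n" "j < n" for b i j
    using pos[of "unit_vec n i + b \<cdot>\<^sub>v unit_vec n j"] form_unit_vecs[OF A that, of b]
    by (simp add: less_eq_complex_def)
  have "Im (A $$ (i, i)) = 0" "Im (A $$ (j, j)) = 0"
    using im[OF ij(1) ij(1), of 0] im[OF ij(2) ij(2), of 0] by auto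
  \<comment> \<open>\<open>b = 1\<close> makes the imaginary parts of the two entries opposite, and
    \<open>b = \<i>\<close> makes their real parts equal.\<close>
  then have "A $$ (j, i) = cnj (A $$ (i, j))"
    using im[OF ij, of 1] im[OF ij, of \<i>] by (simp add: complex_eq_iff)
  then show "mat_adjoint A $$ (i, j) = A $$ (i, j)"
    using A ij by simp
qed (use assms in \<open>auto simp: psd_def\<close>)

text \<open>The basic positivity certificate: the identity, projections, Hermitian squares and
  nonnegative diagonal matrices are all recognised as Gram matrices.\<close>

lemma psd_adjoint_mult:
  assumes "A \<in> carrier_mat m n"
  shows "psd n (mat_adjoint A * A)"
  unfolding psd_def
proof (intro conjI ballI)
  fix v :: "complex vec" assume v: "v \<in> carrier_vec n"
  have "((mat_adjoint A * A) *\<^sub>v v) \<bullet>c v = (A *\<^sub>v v) \<bullet>c (A *\<^sub>v v)"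
    using assms v cscalar_prod_adjoint[of "mat_adjoint A" n m "A *\<^sub>v v" v]
    by (simp add: assoc_mult_mat_vec[of "mat_adjoint A" n m A n v])
  also have "\<dots> \<ge> 0" by (rule conjugate_square_ge_0_vec)
  finally show "0 \<le> ((mat_adjoint A * A) *\<^sub>v v) \<bullet>c v" .
qed (use assms in auto)

lemma psd_hermitian_square:
  "A \<in> carrier_mat n n \<Longrightarrow> hermitian A \<Longrightarrow> psd n (A * A)"
  using psd_adjoint_mult[of A n n] unfolding hermitian_def by simp

lemma psd_add:
  assumes "psd n A" "psd n B"
  shows "psd n (A + B)"
  using assms unfolding psd_def
  by (auto simp: add_mult_distrib_mat_vec[of A n n B] add_scalar_prod_distrib[of _ n])

lemma psd_smult:
  assumes "psd n A" "0 \<le> c"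
  shows "psd n (complex_of_real c \<cdot>\<^sub>m A)"
proof -
  have A: "A \<in> carrier_mat n n" using assms psd_carrier by auto
  have "(complex_of_real c \<cdot>\<^sub>m A *\<^sub>v v) \<bullet>c v = complex_of_real c * ((A *\<^sub>v v) \<bullet>c v)"
    if "v \<in> carrier_vec n" for v
  proof -
    have "complex_of_real c \<cdot>\<^sub>m A *\<^sub>v v = complex_of_real c \<cdot>\<^sub>v (A *\<^sub>v v)"
      using A that by (intro eq_vecI) auto
    then show ?thesis using A that by (simp add: scalar_prod_smult_left[of _ "conjugate v"])
  qed
  then show ?thesis using assms A
    by (auto simp: psd_def less_eq_complex_def)
qed

lemma psd_one: "psd n (1\<^sub>m n)"
  using psd_adjoint_mult[of "1\<^sub>m n" n n] by simp

lemma psd_projection: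
  "A \<in> carrier_mat n n \<Longrightarrow> hermitian A \<Longrightarrow> A * A = A \<Longrightarrow> psd n A"
  using psd_hermitian_square[of A n] by simp

lemma psd_congruence:
  assumes "psd n A" "B \<in> carrier_mat n m"
  shows "psd m (mat_adjoint B * A * B)"
proof -
  have A: "A \<in> carrier_mat n n" using assms psd_carrier by auto
  have "((mat_adjoint B * A * B) *\<^sub>v v) \<bullet>c v = (A *\<^sub>v (B *\<^sub>v v)) \<bullet>c (B *\<^sub>v v)"
    if v: "v \<in> carrier_vec m" for v
  proof -
    have "(mat_adjoint B * A * B) *\<^sub>v v = mat_adjoint B *\<^sub>v (A *\<^sub>v (B *\<^sub>v v))"
      using A assms(2) v mult_carrier_mat[of "mat_adjoint B" m n A n]
      by (simp add: assoc_mult_mat_vec[of "mat_adjoint B * A" m n _ m] assoc_mult_mat_vec[of "mat_adjoint B" m n _ n])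
    then show ?thesis
      using A assms(2) v cscalar_prod_adjoint[of "mat_adjoint B" m n "A *\<^sub>v (B *\<^sub>v v)" v] by simp
  qed
  then show ?thesis using assms A unfolding psd_def by auto
qed

lemma psd_diag_nonneg:
  assumes "psd n A" "i < n"
  shows "0 \<le> Re (A $$ (i, i))"
proof -
  have "0 \<le> (A *\<^sub>v (unit_vec n i + 0 \<cdot>\<^sub>v unit_vec n i)) \<bullet>c (unit_vec n i + 0 \<cdot>\<^sub>v unit_vec n i)"
    using assms unfolding psd_def by (meson add_carrier_vec smult_carrier_vec unit_vec_carrier)
  then show ?thesis
    using form_unit_vecs[of A n i i 0] assms psd_carrier[OF assms(1)] by (simp add: less_eq_complex_def)
qed

lemma psd_tr_nonneg: "psd n A \<Longrightarrow> 0 \<le> Re (tr A)"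
  unfolding tr_def using psd_diag_nonneg[of n A] psd_carrier[of n A] by (auto intro!: sum_nonneg)


section \<open>The spectral theorem\<close>

definition unitary :: "nat \<Rightarrow> complex mat \<Rightarrow> bool" where
  "unitary n U \<longleftrightarrow> U \<in> carrier_mat n n \<and> mat_adjoint U * U = 1\<^sub>m n"

text \<open>Real entries build the reality of the eigenvalues into the spectral theorem, and a
  function on indices lets absolute values and square roots be applied to the spectrum
  directly.\<close>

definition real_diag :: "nat \<Rightarrow> (nat \<Rightarrow> real) \<Rightarrow> complex mat" where
  "real_diag n d = mat n n (\<lambda>(i, j). if i = j then complex_of_real (d i) else 0)"

lemma real_diag_carrier [simp]: "real_diag n d \<in> carrier_mat n n"
  unfolding real_diag_def by simp

lemma real_diag_dim [simp]: "dim_row (real_diag n d) = n" "dim_col (real_diag n d) = n"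
  unfolding real_diag_def by simp_all

lemma real_diag_mult: "real_diag n d * real_diag n e = real_diag n (\<lambda>i. d i * e i)"
proof (rule eq_matI)
  fix i j assume "i < dim_row (real_diag n (\<lambda>i. d i * e i))" "j < dim_col (real_diag n (\<lambda>i. d i * e i))"
  then have ij: "i < n" "j < n" by auto
  then have "(real_diag n d * real_diag n e) $$ (i, j)
     = (\<Sum>k<n. if k = i then (if i = j then complex_of_real (d i * e i) else 0) else 0)"
    unfolding mat_mult_index[OF real_diag_carrier real_diag_carrier ij]
    by (intro sum.cong) (auto simp: real_diag_def)
  then show "(real_diag n d * real_diag n e) $$ (i, j) = real_diag n (\<lambda>i. d i * e i) $$ (i, j)"
    using ij by (simp add: real_diag_def)
qed auto

lemma real_diag_add: "real_diag n d + real_diag n e = real_diag n (\<lambda>i. d i + e i)"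
  unfolding real_diag_def by (intro eq_matI) auto

lemma real_diag_minus: "real_diag n d - real_diag n e = real_diag n (\<lambda>i. d i - e i)"
  unfolding real_diag_def by (intro eq_matI) auto

lemma real_diag_adjoint [simp]: "mat_adjoint (real_diag n d) = real_diag n d"
  unfolding real_diag_def by (intro eq_matI) auto

lemma unitaryD:
  assumes "unitary n U"
  shows "U \<in> carrier_mat n n" "mat_adjoint U \<in> carrier_mat n n"
    "mat_adjoint U * U = 1\<^sub>m n" "U * mat_adjoint U = 1\<^sub>m n"
proof -
  show U: "U \<in> carrier_mat n n" and UU: "mat_adjoint U * U = 1\<^sub>m n"
    using assms unfolding unitary_def by auto
  show aU: "mat_adjoint U \<in> carrier_mat n n" using U by auto
  show "U * mat_adjoint U = 1\<^sub>m n" using mat_mult_left_right_inverse[OF aU U UU] .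
qed

lemma unitary_mult:
  assumes "unitary n U" "unitary n V"
  shows "unitary n (U * V)"
proof -
  note U = unitaryD[OF assms(1)] and V = unitaryD[OF assms(2)]
  have "mat_adjoint (U * V) * (U * V) = mat_adjoint V * (mat_adjoint U * U) * V"
    using U(1,2) V(1,2) by (simp add: mat_adjoint_mult[of U n n V n] assoc_mult_mat[of _ n n _ n _ n] mult_carrier_mat[of _ n n _ n])
  also have "\<dots> = 1\<^sub>m n" using U V by simp
  finally show ?thesis using U V unfolding unitary_def by auto
qed

text \<open>A Householder reflection: with \<open>\<alpha>\<close> the phase of \<open>v\<^sub>0\<close> and \<open>w = v + \<alpha> \<parallel>v\<parallel> e\<^sub>0\<close>, the reflection
  \<open>1 - 2 w w\<^sup>* / \<parallel>w\<parallel>\<^sup>2\<close> sends \<open>v\<close> to a multiple of \<open>e\<^sub>0\<close>.\<close>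

lemma exists_reflection:
  assumes v: "v \<in> carrier_vec (Suc n)" and v0: "v \<noteq> 0\<^sub>v (Suc n)"
  shows "\<exists>U b. unitary (Suc n) U \<and> hermitian U \<and> b \<noteq> 0 \<and> U *\<^sub>v v = b \<cdot>\<^sub>v unit_vec (Suc n) 0"
proof -
  let ?N = "Suc n"
  define N2 where "N2 = (\<Sum>i<?N. (cmod (v $ i))\<^sup>2)"
  have N2_pos: "0 < N2"
  proof -
    obtain i where "i < ?N" "v $ i \<noteq> 0" using v v0 by (metis carrier_vecD eq_vecI index_zero_vec(1,2))
    then show ?thesis unfolding N2_def by (intro sum_pos2[of _ i]) auto
  qed
  define \<alpha> where "\<alpha> = (if v $ 0 = 0 then 1 else v $ 0 / complex_of_real (cmod (v $ 0)))"
  have \<alpha>1: "\<alpha> * cnj \<alpha> = 1" unfolding \<alpha>_def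
    by (auto simp: complex_norm_square[symmetric] norm_divide)
  have \<alpha>2: "v $ 0 = \<alpha> * complex_of_real (cmod (v $ 0))" unfolding \<alpha>_def by auto
  define s where "s = sqrt N2"
  have s: "s > 0" "s * s = N2" using N2_pos unfolding s_def by auto
  define w where "w i = v $ i + (if i = 0 then \<alpha> * complex_of_real s else 0)" for i
  \<comment> \<open>\<open>2 * t\<close> is the squared norm of \<open>w\<close>, so the coefficient
    of the reflection is \<open>1 / t\<close>. With \<alpha> the phase of \<open>v $ 0\<close> the
    two contributions add instead of cancelling, so \<open>t\<close> cannot vanish.\<close>
  define t where "t = N2 + s * cmod (v $ 0)"
  have t: "t > 0" using N2_pos s unfolding t_def by (simp add: add_pos_nonneg)
  have \<alpha>3: "\<alpha> * cnj (v $ 0) = complex_of_real (cmod (v $ 0))" "cnj \<alpha> * v $ 0 = complex_of_real (cmod (v $ 0))"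
    by (subst \<alpha>2, use \<alpha>1 in \<open>simp add: mult.assoc[symmetric] mult.commute\<close>)+
  have sumv: "(\<Sum>i<?N. v $ i * cnj (v $ i)) = complex_of_real N2"
    unfolding N2_def of_real_sum by (intro sum.cong) (simp_all only: complex_norm_square)
  have wv: "(\<Sum>i<?N. cnj (w i) * v $ i) = complex_of_real t"
  proof -
    have "(\<Sum>i<?N. cnj (w i) * v $ i) = (\<Sum>i<?N. v $ i * cnj (v $ i) + (if i = 0 then cnj \<alpha> * complex_of_real s * v $ 0 else 0))"
      by (intro sum.cong) (auto simp: w_def algebra_simps)
    also have "\<dots> = complex_of_real N2 + cnj \<alpha> * complex_of_real s * v $ 0"
      unfolding sum.distrib sumv by simp
    also have "\<dots> = complex_of_real t" using \<alpha>3(2) by (simp add: t_def mult_ac)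
    finally show ?thesis .
  qed
  have ww: "(\<Sum>i<?N. cnj (w i) * w i) = complex_of_real (2 * t)"
  proof -
    have "(\<Sum>i<?N. cnj (w i) * w i) = (\<Sum>i<?N. cnj (w i) * v $ i + (if i = 0 then cnj (w 0) * \<alpha> * complex_of_real s else 0))"
      by (intro sum.cong) (auto simp: w_def algebra_simps)
    also have "\<dots> = complex_of_real t + cnj (w 0) * \<alpha> * complex_of_real s"
      unfolding sum.distrib wv by simp
    also have "cnj (w 0) * \<alpha> * complex_of_real s = (\<alpha> * cnj (v $ 0)) * s + (\<alpha> * cnj \<alpha>) * (s * s)"
      by (simp add: w_def algebra_simps)
    also have "\<dots> = complex_of_real t" unfolding \<alpha>3 \<alpha>1 s(2) by (simp add: t_def)
    finally show ?thesis by simp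
  qed
  define U where "U = mat ?N ?N (\<lambda>(i, j). (if i = j then 1 else 0) - w i * cnj (w j) / complex_of_real t)"
  have U: "U \<in> carrier_mat ?N ?N" unfolding U_def by simp
  have herm: "mat_adjoint U = U" unfolding U_def by (intro eq_matI) (auto simp: mult.commute)
  have "U * U = 1\<^sub>m ?N"
  proof (rule eq_matI)
    fix i j assume "i < dim_row (1\<^sub>m ?N :: complex mat)" "j < dim_col (1\<^sub>m ?N :: complex mat)"
    then have ij: "i < ?N" "j < ?N" by auto
    let ?T = "complex_of_real t"
    have "(U * U) $$ (i, j) = (\<Sum>k<?N. (if k = i then (if i = j then 1 else 0) - w i * cnj (w j) / ?T else 0)
        - (if k = j then w i * cnj (w j) / ?T else 0) + w i * cnj (w j) / ?T\<^sup>2 * (cnj (w k) * w k))"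
      unfolding mat_mult_index[OF U U ij] using ij
      by (intro sum.cong) (auto simp: U_def algebra_simps power2_eq_square)
    also have "\<dots> = (if i = j then 1 else 0) - w i * cnj (w j) / ?T - w i * cnj (w j) / ?T
        + w i * cnj (w j) / ?T\<^sup>2 * complex_of_real (2 * t)"
      unfolding sum.distrib sum_subtractf sum_distrib_left[symmetric] ww using ij by simp
    also have "\<dots> = (if i = j then 1 else 0)" using t by (simp add: field_simps power2_eq_square)
    finally show "(U * U) $$ (i, j) = 1\<^sub>m ?N $$ (i, j)" using ij by simp
  qed (use U in auto)
  moreover have "U *\<^sub>v v = (- \<alpha> * complex_of_real s) \<cdot>\<^sub>v unit_vec ?N 0"
  proof (rule eq_vecI)
    fix i assume "i < dim_vec ((- \<alpha> * complex_of_real s) \<cdot>\<^sub>v unit_vec ?N 0 :: complex vec)"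
    then have i: "i < ?N" by simp
    have "(U *\<^sub>v v) $ i = (\<Sum>k<?N. (if k = i then v $ i else 0) - w i / complex_of_real t * (cnj (w k) * v $ k))"
      using i U v by (auto simp: scalar_prod_def atLeast0LessThan U_def algebra_simps intro!: sum.cong)
    also have "\<dots> = v $ i - w i"
      unfolding sum_subtractf sum_distrib_left[symmetric] wv using i t by simp
    finally show "(U *\<^sub>v v) $ i = ((- \<alpha> * complex_of_real s) \<cdot>\<^sub>v unit_vec ?N 0) $ i"
      using i by (auto simp: w_def)
  qed (use U in auto)
  moreover have "- \<alpha> * complex_of_real s \<noteq> 0" using \<alpha>1 s by auto
  ultimately show ?thesis using U herm unfolding unitary_def hermitian_def by metis
qed

lemma mat_adjoint_four_block_diag:
  fixes A D :: "complex mat"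
  assumes "A \<in> carrier_mat m m" "D \<in> carrier_mat n n"
  shows "mat_adjoint (four_block_mat A (0\<^sub>m m n) (0\<^sub>m n m) D)
    = four_block_mat (mat_adjoint A) (0\<^sub>m m n) (0\<^sub>m n m) (mat_adjoint D)"
  using assms by (intro eq_matI) (auto simp: index_mat_four_block)

text \<open>Induction by deflation. A complex eigenvector exists, and the reflection, which is its
  own inverse, moves it to the first basis vector; the conjugate \<open>K\<close> then has a first
  column with \<open>ev\<close> as its only possibly nonzero entry. Hermiticity clears the first row
  as well and makes \<open>ev\<close> real, leaving a Hermitian block of size
  \<open>n\<close>.\<close>

theorem hermitian_spectral:
  assumes "H \<in> carrier_mat n n" "hermitian H"
  shows "\<exists>U d. unitary n U \<and> H = U * real_diag n d * mat_adjoint U"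
  using assms
proof (induction n arbitrary: H)
  case 0
  have "unitary 0 (1\<^sub>m 0)" unfolding unitary_def by auto
  moreover have "H = 1\<^sub>m 0 * real_diag 0 (\<lambda>_. 0) * mat_adjoint (1\<^sub>m 0)"
    using 0 by (intro eq_matI) auto
  ultimately show ?case by blast
next
  case (Suc n)
  let ?N = "Suc n"
  obtain ev v where evec: "eigenvector H v ev"
    using spectrum_non_empty[OF Suc.prems(1)] unfolding spectrum_def eigenvalue_def by auto
  then have v: "v \<in> carrier_vec ?N" "v \<noteq> 0\<^sub>v ?N" "H *\<^sub>v v = ev \<cdot>\<^sub>v v"
    using Suc.prems unfolding eigenvector_def by auto
  obtain U b where U: "unitary ?N U" "hermitian U" and b: "b \<noteq> 0" "U *\<^sub>v v = b \<cdot>\<^sub>v unit_vec ?N 0"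
    using exists_reflection[OF v(1,2)] by auto
  note Uc = unitaryD(1)[OF U(1)]
  have UU: "U * U = 1\<^sub>m ?N" using U unfolding hermitian_def unitary_def by simp
  define K where "K = U * H * U"
  have K: "K \<in> carrier_mat ?N ?N" using Uc Suc.prems unfolding K_def by auto
  have Kh: "hermitian K" using Uc Suc.prems U(2) unfolding K_def hermitian_def
    by (simp add: mat_adjoint_mult[of _ ?N ?N _ ?N] assoc_mult_mat[of _ ?N ?N _ ?N _ ?N] mult_carrier_mat[of _ ?N ?N _ ?N])
  have Ke: "K *\<^sub>v unit_vec ?N 0 = ev \<cdot>\<^sub>v unit_vec ?N 0"
  proof -
    \<comment> \<open>The reflection fixes the image of \<open>v\<close> only up to the nonzero
      factor \<open>b\<close>, which is carried along and cancelled at the end.\<close>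
    have "b \<cdot>\<^sub>v (K *\<^sub>v unit_vec ?N 0) = K *\<^sub>v (U *\<^sub>v v)" using K b by (simp add: mult_mat_vec[of _ ?N ?N])
    also have "\<dots> = U *\<^sub>v (H *\<^sub>v ((U * U) *\<^sub>v v))"
      using Uc Suc.prems v unfolding K_def
      by (simp add: assoc_mult_mat_vec[of _ ?N ?N _ ?N])
    also have "\<dots> = ev \<cdot>\<^sub>v (b \<cdot>\<^sub>v unit_vec ?N 0)"
      using UU v Uc b by (simp add: mult_mat_vec[of _ ?N ?N])
    finally have *: "b \<cdot>\<^sub>v (K *\<^sub>v unit_vec ?N 0) = ev \<cdot>\<^sub>v (b \<cdot>\<^sub>v unit_vec ?N 0)" .
    have "inverse b \<cdot>\<^sub>v (b \<cdot>\<^sub>v (K *\<^sub>v unit_vec ?N 0)) = inverse b \<cdot>\<^sub>v (ev \<cdot>\<^sub>v (b \<cdot>\<^sub>v unit_vec ?N 0))"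
      unfolding * ..
    then have "(inverse b * b) \<cdot>\<^sub>v (K *\<^sub>v unit_vec ?N 0) = (inverse b * ev * b) \<cdot>\<^sub>v unit_vec ?N 0"
      by (simp only: smult_smult_assoc mult.assoc)
    moreover have "inverse b * b = 1" "inverse b * ev * b = ev" using b(1) by auto
    ultimately show ?thesis by (simp only: one_smult_vec)
  qed
  have col: "K $$ (i, 0) = (if i = 0 then ev else 0)" if "i < ?N" for i
    using mult_mat_unit_vec_index[OF K that, of 0] Ke that by (auto simp: unit_vec_def)
  have row: "K $$ (0, j) = (if j = 0 then ev else 0)" if "j < ?N" for j
    using hermitian_index[OF Kh K, of 0 j] col[of 0] col[OF that] that by (cases "j = 0") simp_all
  have "ev = cnj ev" using hermitian_index[OF Kh K, of 0 0] col[of 0] by simp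
  then have lam: "ev = complex_of_real (Re ev)" by (simp add: complex_eq_iff)
  define H' where "H' = mat n n (\<lambda>(i, j). K $$ (Suc i, Suc j))"
  have H': "H' \<in> carrier_mat n n" unfolding H'_def by simp
  have H'h: "hermitian H'" unfolding hermitian_def
  proof (rule eq_matI)
    fix i j assume "i < dim_row H'" "j < dim_col H'"
    then have ij: "i < n" "j < n" unfolding H'_def by auto
    then show "mat_adjoint H' $$ (i, j) = H' $$ (i, j)"
      using hermitian_index[OF Kh K, of "Suc i" "Suc j"] unfolding H'_def by simp
  qed (auto simp: H'_def)
  obtain W d where W: "unitary n W" and H'eq: "H' = W * real_diag n d * mat_adjoint W"
    using Suc.IH[OF H' H'h] by blast
  note Wc = unitaryD[OF W]
  let ?z = "0\<^sub>m 1 n" and ?z' = "0\<^sub>m n 1"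
  define B where "B X Y = four_block_mat X ?z ?z' Y" for X Y :: "complex mat"
  have Bm: "B X Y * B X' Y' = B (X * X') (Y * Y')"
    if "X \<in> carrier_mat 1 1" "X' \<in> carrier_mat 1 1" "Y \<in> carrier_mat n n" "Y' \<in> carrier_mat n n" for X Y X' Y'
    unfolding B_def using that by (subst mult_four_block_mat[of _ 1 1 _ n _ n _ _ 1 _ n]) auto
  have Bc: "B X Y \<in> carrier_mat ?N ?N"
    if "X \<in> carrier_mat 1 1" "Y \<in> carrier_mat n n" for X Y
    using four_block_carrier_mat[OF that] unfolding B_def by simp
  define V where "V = B (1\<^sub>m 1) W"
  define e where "e = (\<lambda>i. case i of 0 \<Rightarrow> Re ev | Suc i \<Rightarrow> d i)"
  have Va: "mat_adjoint V = B (1\<^sub>m 1) (mat_adjoint W)"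
    unfolding V_def B_def using Wc by (subst mat_adjoint_four_block_diag) auto
  have V: "unitary ?N V"
    unfolding unitary_def Va using Wc
    by (auto simp: V_def Bm Bc) (simp add: B_def)
  have De: "real_diag ?N e = B (real_diag 1 (\<lambda>_. Re ev)) (real_diag n d)"
    unfolding B_def by (intro eq_matI) (auto simp: real_diag_def e_def index_mat_four_block split: nat.splits)
  have KB: "K = B (real_diag 1 (\<lambda>_. Re ev)) H'"
    unfolding B_def using K lam
    by (intro eq_matI) (auto simp: real_diag_def H'_def index_mat_four_block col row less_Suc_eq_0_disj)
  have KV: "K = V * real_diag ?N e * mat_adjoint V"
    unfolding KB H'eq De Va using Wc unfolding V_def by (simp add: Bm)
  have "H = (U * U) * H * (U * U)" using UU Suc.prems by simp
  also have "\<dots> = U * K * U" unfolding K_def using Uc Suc.prems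
    by (simp add: assoc_mult_mat[of _ ?N ?N _ ?N _ ?N] mult_carrier_mat[of _ ?N ?N _ ?N])
  also have "\<dots> = (U * V) * real_diag ?N e * mat_adjoint (U * V)"
    using Uc unitaryD[OF V] U(2) unfolding KV hermitian_def
    by (simp add: mat_adjoint_mult[of _ ?N ?N _ ?N] assoc_mult_mat[of _ ?N ?N _ ?N _ ?N] mult_carrier_mat[of _ ?N ?N _ ?N])
  finally show ?case using unitary_mult[OF U(1) V] by blast
qed

section \<open>Square roots and the trace norm\<close>

lemma real_diag_cong: "(\<And>i. i < n \<Longrightarrow> d i = e i) \<Longrightarrow> real_diag n d = real_diag n e"
  unfolding real_diag_def by (intro eq_matI) auto

lemma psd_unitary_diag:
  assumes "unitary n U" "\<And>i. i < n \<Longrightarrow> 0 \<le> d i"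
  shows "psd n (U * real_diag n d * mat_adjoint U)"
proof -
  have "real_diag n d = real_diag n (\<lambda>i. sqrt (d i)) * real_diag n (\<lambda>i. sqrt (d i))"
    unfolding real_diag_mult using assms(2) by (intro real_diag_cong) auto
  then have "psd n (real_diag n d)"
    using psd_adjoint_mult[of "real_diag n (\<lambda>i. sqrt (d i))" n n] by simp
  then show ?thesis
    using psd_congruence[of n "real_diag n d" "mat_adjoint U" n] unitaryD[OF assms(1)] by simp
qed

text \<open>With the two lemmas that follow, this is a functional calculus: in a fixed eigenbasis,
  products, sums and differences are computed on eigenvalues.\<close>

lemma unitary_diag_mult:
  assumes "unitary n U"
  shows "(U * real_diag n d * mat_adjoint U) * (U * real_diag n e * mat_adjoint U)
    = U * real_diag n (\<lambda>i. d i * e i) * mat_adjoint U"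
proof -
  note U = unitaryD[OF assms]
  note ca = assoc_mult_mat[of _ n n _ n _ n] mult_carrier_mat[of _ n n _ n]
  have "(U * real_diag n d * mat_adjoint U) * (U * real_diag n e * mat_adjoint U)
    = U * (real_diag n d * ((mat_adjoint U * U) * real_diag n e)) * mat_adjoint U"
    using U(1,2) by (simp add: ca)
  also have "\<dots> = U * (real_diag n d * real_diag n e) * mat_adjoint U"
    using U by simp
  finally show ?thesis unfolding real_diag_mult .
qed

lemma unitary_diag_add:
  assumes "unitary n U"
  shows "U * real_diag n d * mat_adjoint U + U * real_diag n e * mat_adjoint U
    = U * real_diag n (\<lambda>i. d i + e i) * mat_adjoint U"
  using unitaryD[OF assms]
  by (simp add: real_diag_add[symmetric] mult_add_distrib_mat[of _ n n _ n] add_mult_distrib_mat[of _ n n _ _ n] mult_carrier_mat[of _ n n _ n])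

lemma unitary_diag_minus:
  assumes "unitary n U"
  shows "U * real_diag n d * mat_adjoint U - U * real_diag n e * mat_adjoint U
    = U * real_diag n (\<lambda>i. d i - e i) * mat_adjoint U"
  using unitaryD[OF assms]
  by (simp add: real_diag_minus[symmetric] mult_minus_distrib_mat[of _ n n _ n] minus_mult_distrib_mat[of _ n n _ _ n] mult_carrier_mat[of _ n n _ n])

lemma unitary_conj_cancel:
  assumes "unitary n U" "A \<in> carrier_mat n n"
  shows "U * (mat_adjoint U * A * U) * mat_adjoint U = A" "mat_adjoint U * (U * A * mat_adjoint U) * U = A"
proof -
  note U = unitaryD[OF assms(1)]
  note ca = assoc_mult_mat[of _ n n _ n _ n] mult_carrier_mat[of _ n n _ n]
  have "U * (mat_adjoint U * A * U) * mat_adjoint U = (U * mat_adjoint U) * A * (U * mat_adjoint U)"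
    using U(1,2) assms(2) by (simp add: ca)
  also have "\<dots> = A" unfolding U(4) using assms(2) by simp
  finally show "U * (mat_adjoint U * A * U) * mat_adjoint U = A" .
  have "mat_adjoint U * (U * A * mat_adjoint U) * U = (mat_adjoint U * U) * A * (mat_adjoint U * U)"
    using U(1,2) assms(2) by (simp add: ca)
  also have "\<dots> = A" unfolding U(3) using assms(2) by simp
  finally show "mat_adjoint U * (U * A * mat_adjoint U) * U = A" .
qed

text \<open>Replacing each eigenvalue by its absolute value works for all four conditions at once,
  because \<open>\<bar>d i\<bar> + d i\<close> and \<open>\<bar>d i\<bar> - d i\<close> are
  nonnegative.\<close>

lemma exists_abs:
  assumes "H \<in> carrier_mat n n" "hermitian H"
  shows "\<exists>S. psd n S \<and> S * S = H * H \<and> psd n (S + H) \<and> psd n (S - H)"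
proof -
  obtain U d where U: "unitary n U" and H: "H = U * real_diag n d * mat_adjoint U"
    using hermitian_spectral[OF assms] by blast
  show ?thesis
    by (rule exI[of _ "U * real_diag n (\<lambda>i. \<bar>d i\<bar>) * mat_adjoint U"])
      (auto simp: H unitary_diag_mult[OF U] unitary_diag_add[OF U] unitary_diag_minus[OF U]
        intro!: psd_unitary_diag[OF U])
qed

lemma exists_psd_sqrt:
  assumes "psd n A"
  shows "\<exists>S. psd n S \<and> S * S = A"
proof -
  note A = psd_carrier[OF assms]
  obtain U d where U: "unitary n U" and H: "A = U * real_diag n d * mat_adjoint U"
    using hermitian_spectral[OF A psd_hermitian[OF assms]] by blast
  \<comment> \<open>Conjugating back keeps positivity and exhibits the eigenvalues as diagonal
    entries, hence as nonnegative numbers.\<close>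
  have "psd n (mat_adjoint U * A * U)" using psd_congruence[OF assms unitaryD(1)[OF U]] .
  then have "psd n (real_diag n d)" unfolding H using unitary_conj_cancel[OF U] by simp
  then have d: "0 \<le> d i" if "i < n" for i
    using psd_diag_nonneg[of n "real_diag n d" i] that by (simp add: real_diag_def)
  have "U * real_diag n (\<lambda>i. sqrt (d i) * sqrt (d i)) * mat_adjoint U = A"
    unfolding H using d by (simp cong: real_diag_cong)
  then show ?thesis
    using d by (intro exI[of _ "U * real_diag n (\<lambda>i. sqrt (d i)) * mat_adjoint U"])
      (auto simp: unitary_diag_mult[OF U] intro!: psd_unitary_diag[OF U])
qed

text \<open>In an eigenbasis of \<open>S - T\<close> the diagonal of
  \<open>S\<^sup>2 - T\<^sup>2 = S (S - T) + (S - T) T\<close> reads \<open>d\<^sub>i (S\<^sub>i\<^sub>i + T\<^sub>i\<^sub>i) = 0\<close>, where \<open>d\<^sub>i = S\<^sub>i\<^sub>i - T\<^sub>i\<^sub>i\<close>.\<close>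

lemma psd_square_inj:
  assumes "psd n S" "psd n T" "S * S = T * T"
  shows "S = T"
proof -
  note S = psd_carrier[OF assms(1)] and T = psd_carrier[OF assms(2)]
  note ca = assoc_mult_mat[of _ n n _ n _ n] mult_carrier_mat[of _ n n _ n]
  have "S - T \<in> carrier_mat n n" "hermitian (S - T)"
    using hermitian_minus[OF S T] psd_hermitian assms(1,2) S T by auto
  then obtain U d where U: "unitary n U" and ST: "S - T = U * real_diag n d * mat_adjoint U"
    using hermitian_spectral by blast
  note Uc = unitaryD[OF U]
  define C where "C = mat_adjoint U * S * U"
  define E where "E = mat_adjoint U * T * U"
  have psd: "psd n C" "psd n E"
    using psd_congruence[OF assms(1) Uc(1)] psd_congruence[OF assms(2) Uc(1)] unfolding C_def E_def by auto
  note C = psd_carrier[OF psd(1)] and E = psd_carrier[OF psd(2)]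
  have CE: "C - E = real_diag n d"
  proof -
    have "C - E = mat_adjoint U * (S - T) * U"
      unfolding C_def E_def using Uc(1,2) S T
      by (simp add: mult_minus_distrib_mat[of _ n n _ n] minus_mult_distrib_mat[of _ n n _ _ n] ca(2))
    then show ?thesis unfolding ST using unitary_conj_cancel[OF U] by simp
  qed
  have "C * C = mat_adjoint U * (S * ((U * mat_adjoint U) * S)) * U"
    unfolding C_def using Uc(1,2) S by (simp add: ca)
  moreover have "E * E = mat_adjoint U * (T * ((U * mat_adjoint U) * T)) * U"
    unfolding E_def using Uc(1,2) T by (simp add: ca)
  ultimately have sq: "C * C = E * E" using assms(3) S T Uc by simp
  have "d i = 0" if i: "i < n" for i
  proof -
    have Cij: "C $$ (k, j) = E $$ (k, j) + (if k = j then complex_of_real (d k) else 0)" if "k < n" "j < n" for k j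
    proof -
      have "(C - E) $$ (k, j) = C $$ (k, j) - E $$ (k, j)" using that C E by auto
      then show ?thesis unfolding CE using that by (simp add: real_diag_def)
    qed
    have "0 = (C * C) $$ (i, i) - (E * E) $$ (i, i)" using sq by simp
    also have "\<dots> = (\<Sum>k<n. C $$ (i, k) * (C $$ (k, i) - E $$ (k, i)) + (C $$ (i, k) - E $$ (i, k)) * E $$ (k, i))"
      unfolding mat_mult_index[OF C C i i] mat_mult_index[OF E E i i] sum_subtractf[symmetric]
      by (simp add: algebra_simps)
    also have "\<dots> = (\<Sum>k<n. (if k = i then complex_of_real (d i) * (C $$ (i, i) + E $$ (i, i)) else 0))"
      using i by (intro sum.cong) (auto simp: Cij algebra_simps)
    also have "\<dots> = complex_of_real (d i) * (C $$ (i, i) + E $$ (i, i))" using i by simp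
    finally have "d i * (Re (C $$ (i, i)) + Re (E $$ (i, i))) = 0"
      by (metis Re_complex_of_real mult_eq_0_iff plus_complex.sel(1) zero_complex.sel(1) of_real_0)
    moreover have "Re (C $$ (i, i)) = Re (E $$ (i, i)) + d i" using Cij[OF i i] by simp
    \<comment> \<open>If \<open>d i\<close> were nonzero, two nonnegative diagonal entries would sum
      to zero; both would vanish, and so would their difference \<open>d i\<close>.\<close>
    ultimately show ?thesis using psd_diag_nonneg[OF psd(1) i] psd_diag_nonneg[OF psd(2) i] by auto
  qed
  then have "C = E" using CE C E
    by (intro eq_matI) (auto simp: mat_eq_iff real_diag_def split: if_splits)
  then show ?thesis
    by (metis unitary_conj_cancel(1)[OF U S] unitary_conj_cancel(1)[OF U T] C_def E_def)
qed

text \<open>Evaluates the definite description: any positive semidefinite root that has been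
  exhibited is the one that \<open>trace_norm\<close> uses.\<close>

lemma psd_sqrt_unique:
  assumes "psd n S" "S * S = A"
  shows "psd_sqrt A = S"
proof -
  have "dim_row A = n" using psd_carrier[OF assms(1)] assms(2) by auto
  then show ?thesis unfolding psd_sqrt_def
    using assms by (intro the_equality) (auto intro: psd_square_inj)
qed

text \<open>The bridge from the trace norm to the domination relation: for Hermitian
  \<open>H\<close> the root of \<open>mat_adjoint H * H\<close> is the absolute value of
  \<open>H\<close>, which bounds \<open>H\<close> from both sides.\<close>

lemma trace_norm_abs:
  assumes "H \<in> carrier_mat n n" "hermitian H"
  obtains S where "psd n S" "psd n (S + H)" "psd n (S - H)" "Re (tr S) = trace_norm H"
proof -
  obtain S where S: "psd n S" "S * S = H * H" "psd n (S + H)" "psd n (S - H)"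
    using exists_abs[OF assms] by auto
  have "psd_sqrt (mat_adjoint H * H) = S"
    using psd_sqrt_unique[OF S(1,2)] assms(2) unfolding hermitian_def by simp
  then show ?thesis using S that unfolding trace_norm_def by auto
qed

section \<open>Traces of products and the domination relation\<close>

lemma tr_add: "A \<in> carrier_mat n n \<Longrightarrow> B \<in> carrier_mat n n \<Longrightarrow> tr (A + B) = tr A + tr B"
  unfolding tr_def by (auto simp: sum.distrib)

lemma tr_minus: "A \<in> carrier_mat n n \<Longrightarrow> B \<in> carrier_mat n n \<Longrightarrow> tr (A - B) = tr A - tr B"
  unfolding tr_def by (auto simp: sum_subtractf)

lemma tr_smult: "tr (c \<cdot>\<^sub>m A) = c * tr A" if "A \<in> carrier_mat n n"
  using that unfolding tr_def by (auto simp: sum_distrib_left)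

lemma tr_mult:
  assumes "A \<in> carrier_mat n m" "B \<in> carrier_mat m n"
  shows "tr (A * B) = (\<Sum>i<n. \<Sum>j<m. A $$ (i, j) * B $$ (j, i))"
  unfolding tr_def using assms by (auto simp: mat_mult_index[OF assms] simp del: index_mult_mat(1) intro!: sum.cong)

lemma tr_mult_commute:
  assumes "A \<in> carrier_mat n m" "B \<in> carrier_mat m n"
  shows "tr (A * B) = tr (B * A)"
  unfolding tr_mult[OF assms] tr_mult[OF assms(2,1)] by (subst sum.swap) (simp add: mult.commute)

text \<open>\<open>A * B\<close> itself need not be positive, but splitting \<open>B = S * S\<close>
  and cycling the trace turns it into the congruence \<open>S * A * S\<close>.\<close>

lemma psd_tr_mult_nonneg:
  assumes "psd n A" "psd n B"
  shows "0 \<le> Re (tr (A * B))"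
proof -
  obtain S where S: "psd n S" "S * S = B" using exists_psd_sqrt[OF assms(2)] by auto
  note c = psd_carrier[OF assms(1)] psd_carrier[OF S(1)]
  have "tr (A * B) = tr ((A * S) * S)" using c S(2) by (simp add: assoc_mult_mat[of A n n S n S n])
  also have "\<dots> = tr (S * (A * S))" using c by (intro tr_mult_commute[of _ n n]) auto
  also have "\<dots> = tr (mat_adjoint S * A * S)"
    using c psd_hermitian[OF S(1)] unfolding hermitian_def by (simp add: assoc_mult_mat[of S n n A n S n])
  finally show ?thesis using psd_tr_nonneg[OF psd_congruence[OF assms(1) c(2)]] by simp
qed

text \<open>An order substitute for an absolute value. \<open>S\<close> is the average of two
  positive semidefinite matrices, hence positive semidefinite, but it need not be the absolute value
  of \<open>H\<close> nor commute with it. This freedom is what admits an arbitrary \<open>Y\<close>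
  as a bound for the partial transpose of \<open>P\<close>.\<close>

definition dominated :: "nat \<Rightarrow> complex mat \<Rightarrow> complex mat \<Rightarrow> bool" where
  "dominated n S H \<longleftrightarrow> S \<in> carrier_mat n n \<and> H \<in> carrier_mat n n \<and> psd n (S + H) \<and> psd n (S - H)"

text \<open>Pair \<open>S + H\<close> with \<open>T \<mp> K\<close> and \<open>S - H\<close> with \<open>T \<plusminus> K\<close>.\<close>

lemma dominated_tr_mult_le:
  assumes "dominated n S H" "dominated n T K"
  shows "\<bar>Re (tr (H * K))\<bar> \<le> Re (tr (S * T))"
proof -
  have c: "S \<in> carrier_mat n n" "H \<in> carrier_mat n n" "T \<in> carrier_mat n n" "K \<in> carrier_mat n n"
    and p: "psd n (S + H)" "psd n (S - H)" "psd n (T + K)" "psd n (T - K)"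
    using assms unfolding dominated_def by auto
  have "tr ((S + H) * (T - K)) + tr ((S - H) * (T + K)) = 2 * tr (S * T) - 2 * tr (H * K)"
    "tr ((S + H) * (T + K)) + tr ((S - H) * (T - K)) = 2 * tr (S * T) + 2 * tr (H * K)"
    using c by (simp_all add: mult_add_distrib_mat[of _ n n _ n] add_mult_distrib_mat[of _ n n _ _ n]
       mult_minus_distrib_mat[of _ n n _ n] minus_mult_distrib_mat[of _ n n _ _ n]
       mult_carrier_mat[of _ n n _ n] minus_carrier_mat tr_add[of _ n] tr_minus[of _ n])
  then have "Re (tr ((S + H) * (T - K))) + Re (tr ((S - H) * (T + K))) = 2 * Re (tr (S * T)) - 2 * Re (tr (H * K))"
    "Re (tr ((S + H) * (T + K))) + Re (tr ((S - H) * (T - K))) = 2 * Re (tr (S * T)) + 2 * Re (tr (H * K))"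
    by (simp_all add: complex_eq_iff)
  then show ?thesis
    using psd_tr_mult_nonneg[OF p(1,4)] psd_tr_mult_nonneg[OF p(2,3)]
      psd_tr_mult_nonneg[OF p(1,3)] psd_tr_mult_nonneg[OF p(2,4)] by linarith
qed

text \<open>\<open>1 - K\<close> is again a projection, hence positive.\<close>

lemma dominated_projection:
  assumes "K \<in> carrier_mat n n" "hermitian K" "K * K = K"
  shows "dominated n (1\<^sub>m n) K"
proof -
  let ?Q = "1\<^sub>m n - K"
  have "?Q * ?Q = ?Q - K * ?Q"
    using assms minus_mult_distrib_mat[of "1\<^sub>m n" n n K ?Q n] minus_carrier_mat[of K n n] by simp
  also have "K * ?Q = 0\<^sub>m n n"
    using assms mult_minus_distrib_mat[of K n n "1\<^sub>m n" n K] by simp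
  also have "?Q - 0\<^sub>m n n = ?Q"
    using assms(1) by (intro eq_matI) auto
  finally have "?Q * ?Q = ?Q" .
  then have "psd n ?Q"
    using assms by (intro psd_projection hermitian_minus) (auto simp: hermitian_def)
  moreover have "psd n (1\<^sub>m n + K)" using psd_add[OF psd_one psd_projection[OF assms]] .
  ultimately show ?thesis using assms unfolding dominated_def by simp
qed

text \<open>A case of the Hoelder inequality, obtained by pairing the absolute value of
  \<open>D\<close> with the identity. It converts a small trace-norm error into nearly equal weights
  on a test projection.\<close>

lemma tr_mult_le_trace_norm:
  assumes "D \<in> carrier_mat n n" "hermitian D" "K \<in> carrier_mat n n" "hermitian K" "K * K = K"
  shows "\<bar>Re (tr (D * K))\<bar> \<le> trace_norm D"
proof -
  obtain S where S: "psd n S" "psd n (S + D)" "psd n (S - D)" "Re (tr S) = trace_norm D"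
    using trace_norm_abs[OF assms(1,2)] .
  then have "dominated n S D" using assms psd_carrier unfolding dominated_def by auto
  from dominated_tr_mult_le[OF this dominated_projection[OF assms(3-5)]]
  show ?thesis using S psd_carrier[OF S(1)] by simp
qed

lemma dominated_self:
  assumes "psd n A"
  shows "dominated n A A"
proof -
  note A = psd_carrier[OF assms]
  have "A - A = mat_adjoint (0\<^sub>m n n) * 0\<^sub>m n n" using A by (intro eq_matI) auto
  then have "psd n (A - A)" using psd_adjoint_mult[of "0\<^sub>m n n" n n] by simp
  then show ?thesis using psd_add[OF assms assms] A by (simp add: dominated_def)
qed


section \<open>Tensor products and partial transposes\<close>

lemma bip_index_less: "i < m \<Longrightarrow> j < n \<Longrightarrow> i * n + j < m * (n :: nat)"
  by (metis add.commute mult.commute mult_le_mono2 nat_mult_less_cancel_disj less_Suc_eq_le Suc_leI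
      add_less_le_mono mult_Suc_right order_less_le_trans nat_add_left_cancel_less)

lemma sum_prod_index:
  fixes f :: "nat \<Rightarrow> 'a :: comm_monoid_add"
  shows "(\<Sum>r<m * n. f r) = (\<Sum>i<m. \<Sum>j<n. f (i * n + j))"
proof (induction m)
  case (Suc m)
  have "(\<Sum>r<Suc m * n. f r) = (\<Sum>r<m * n. f r) + (\<Sum>r = m * n..<m * n + n. f r)"
    by (simp add: sum.atLeastLessThan_concat lessThan_atLeast0 add.commute)
  also have "(\<Sum>r = m * n..<m * n + n. f r) = (\<Sum>j<n. f (m * n + j))"
    using sum.shift_bounds_nat_ivl[of f 0 "m * n" n] by (simp add: lessThan_atLeast0 add.commute)
  finally show ?case using Suc.IH by simp
qed simp

text \<open>Quotients and remainders of the indices run independently, so the sum factors. Both the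
  product rule and the trace of a tensor product are instances.\<close>

lemma sum_tensor_index:
  fixes f g :: "nat \<Rightarrow> nat \<Rightarrow> complex"
  shows "(\<Sum>a<m * m'. \<Sum>b<n * n'. f (a div m') (b div n') * g (a mod m') (b mod n'))
    = (\<Sum>a<m. \<Sum>b<n. f a b) * (\<Sum>a<m'. \<Sum>b<n'. g a b)"
proof -
  have "(\<Sum>a<m * m'. \<Sum>b<n * n'. f (a div m') (b div n') * g (a mod m') (b mod n'))
    = (\<Sum>a<m. \<Sum>a'<m'. \<Sum>b<n. \<Sum>b'<n'. f a b * g a' b')"
    unfolding sum_prod_index by (intro sum.cong) auto
  also have "\<dots> = (\<Sum>a<m. \<Sum>b<n. \<Sum>a'<m'. \<Sum>b'<n'. f a b * g a' b')"
    by (intro sum.cong sum.swap refl)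
  also have "\<dots> = (\<Sum>a<m. \<Sum>b<n. f a b) * (\<Sum>a<m'. \<Sum>b<n'. g a b)"
    by (simp only: sum_distrib_right) (simp only: sum_distrib_left)
  finally show ?thesis .
qed

lemma bip_mat_carrier [simp]: "bip_mat dA dB f \<in> carrier_mat (dA * dB) (dA * dB)"
  unfolding bip_mat_def by simp

lemma bip_entry_bip_mat:
  "i < dA \<Longrightarrow> j < dB \<Longrightarrow> k < dA \<Longrightarrow> l < dB \<Longrightarrow> bip_entry dB (bip_mat dA dB f) i j k l = f i j k l"
  unfolding bip_entry_def bip_mat_def by (simp add: bip_index_less)

lemma bip_eqI:
  assumes "X \<in> carrier_mat (dA * dB) (dA * dB)" "Y \<in> carrier_mat (dA * dB) (dA * dB)"
    and "\<And>i j k l. i < dA \<Longrightarrow> j < dB \<Longrightarrow> k < dA \<Longrightarrow> l < dB \<Longrightarrow> bip_entry dB X i j k l = bip_entry dB Y i j k l"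
  shows "X = Y"
proof (rule eq_matI)
  fix r c assume "r < dim_row Y" "c < dim_col Y"
  then have rc: "r < dA * dB" "c < dA * dB" using assms(2) by auto
  \<comment> \<open>A valid index exists, so \<open>dB\<close> is nonzero and the remainder modulo
    \<open>dB\<close> is a valid index for Bob.\<close>
  then have "0 < dB" by (metis mult_0_right not_less0 gr0I)
  then have "bip_entry dB X (r div dB) (r mod dB) (c div dB) (c mod dB) = bip_entry dB Y (r div dB) (r mod dB) (c div dB) (c mod dB)"
    using rc by (intro assms(3)) (auto simp: less_mult_imp_div_less)
  then show "X $$ (r, c) = Y $$ (r, c)" unfolding bip_entry_def by simp
qed (use assms in auto)

context
  fixes dA dB :: nat and X Y :: "complex mat"
  assumes X: "X \<in> carrier_mat (dA * dB) (dA * dB)" and Y: "Y \<in> carrier_mat (dA * dB) (dA * dB)"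
begin

lemma bip_entry_add:
  "i < dA \<Longrightarrow> j < dB \<Longrightarrow> k < dA \<Longrightarrow> l < dB \<Longrightarrow>
    bip_entry dB (X + Y) i j k l = bip_entry dB X i j k l + bip_entry dB Y i j k l"
  using X Y unfolding bip_entry_def by (auto simp: bip_index_less)

lemma bip_entry_minus:
  "i < dA \<Longrightarrow> j < dB \<Longrightarrow> k < dA \<Longrightarrow> l < dB \<Longrightarrow>
    bip_entry dB (X - Y) i j k l = bip_entry dB X i j k l - bip_entry dB Y i j k l"
  using X Y unfolding bip_entry_def by (auto simp: bip_index_less)

lemma bip_entry_smult:
  "i < dA \<Longrightarrow> j < dB \<Longrightarrow> k < dA \<Longrightarrow> l < dB \<Longrightarrow>
    bip_entry dB (c \<cdot>\<^sub>m X) i j k l = c * bip_entry dB X i j k l"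
  using X unfolding bip_entry_def by (auto simp: bip_index_less)

lemma bip_entry_adjoint:
  "i < dA \<Longrightarrow> j < dB \<Longrightarrow> k < dA \<Longrightarrow> l < dB \<Longrightarrow>
    bip_entry dB (mat_adjoint X) i j k l = cnj (bip_entry dB X k l i j)"
  using X unfolding bip_entry_def by (auto simp: bip_index_less)

lemma bip_entry_mult:
  "i < dA \<Longrightarrow> j < dB \<Longrightarrow> k < dA \<Longrightarrow> l < dB \<Longrightarrow>
    bip_entry dB (X * Y) i j k l = (\<Sum>a<dA. \<Sum>b<dB. bip_entry dB X i j a b * bip_entry dB Y a b k l)"
  unfolding bip_entry_def by (simp only: mat_mult_index[OF X Y] bip_index_less sum_prod_index)

lemma bip_tr: "tr X = (\<Sum>i<dA. \<Sum>j<dB. bip_entry dB X i j i j)"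
  using X unfolding bip_entry_def tr_def sum_prod_index[symmetric, of "\<lambda>r. X $$ (r, r)"] by auto

lemma bip_tr_mult:
  "tr (X * Y) = (\<Sum>i<dA. \<Sum>j<dB. \<Sum>k<dA. \<Sum>l<dB. bip_entry dB X i j k l * bip_entry dB Y k l i j)"
  unfolding tr_mult[OF X Y] bip_entry_def sum_prod_index ..

end

lemma bip_entry_one:
  assumes "i < dA" "j < dB" "k < dA" "l < dB"
  shows "bip_entry dB (1\<^sub>m (dA * dB)) i j k l = (if i = k \<and> j = l then 1 else 0)"
proof -
  have "i * dB + j = k * dB + l \<longleftrightarrow> i = k \<and> j = l"
    using assms by (metis add.commute mult.commute div_mult_self3 div_less mod_mult_self3 mod_less add_0 not_less0 bot_nat_0.not_eq_extremum)
  then show ?thesis using assms unfolding bip_entry_def by (simp add: bip_index_less)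
qed

section \<open>Tensor products of bipartite operators\<close>

lemma bip_tensor_carrier [simp]:
  "bip_tensor dA dB X dA' dB' X' \<in> carrier_mat ((dA * dA') * (dB * dB')) ((dA * dA') * (dB * dB'))"
  unfolding bip_tensor_def by simp

lemma bip_entry_tensor:
  "i < dA * dA' \<Longrightarrow> j < dB * dB' \<Longrightarrow> k < dA * dA' \<Longrightarrow> l < dB * dB' \<Longrightarrow>
    bip_entry (dB * dB') (bip_tensor dA dB X dA' dB' X') i j k l =
      bip_entry dB X (i div dA') (j div dB') (k div dA') (l div dB') *
      bip_entry dB' X' (i mod dA') (j mod dB') (k mod dA') (l mod dB')"
  unfolding bip_tensor_def by (simp add: bip_entry_bip_mat)

lemma prod_index_bounds:
  assumes "i < m * (n :: nat)"
  shows "i div n < m" "i mod n < n"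
  using assms by (auto simp: less_mult_imp_div_less intro!: mod_less_divisor gr0I)

lemma bip_tensor_mult:
  assumes "X \<in> carrier_mat (dA * dB) (dA * dB)" "Y \<in> carrier_mat (dA * dB) (dA * dB)"
    "X' \<in> carrier_mat (dA' * dB') (dA' * dB')" "Y' \<in> carrier_mat (dA' * dB') (dA' * dB')"
  shows "bip_tensor dA dB (X * Y) dA' dB' (X' * Y')
    = bip_tensor dA dB X dA' dB' X' * bip_tensor dA dB Y dA' dB' Y'"
proof (rule bip_eqI[of _ "dA * dA'" "dB * dB'"])
  fix i j k l assume b: "i < dA * dA'" "j < dB * dB'" "k < dA * dA'" "l < dB * dB'"
  note b' = prod_index_bounds[OF b(1)] prod_index_bounds[OF b(2)] prod_index_bounds[OF b(3)] prod_index_bounds[OF b(4)]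
  have "bip_entry (dB * dB') (bip_tensor dA dB X dA' dB' X' * bip_tensor dA dB Y dA' dB' Y') i j k l
    = (\<Sum>a<dA * dA'. \<Sum>b<dB * dB'.
        (bip_entry dB X (i div dA') (j div dB') (a div dA') (b div dB') * bip_entry dB Y (a div dA') (b div dB') (k div dA') (l div dB')) *
        (bip_entry dB' X' (i mod dA') (j mod dB') (a mod dA') (b mod dB') * bip_entry dB' Y' (a mod dA') (b mod dB') (k mod dA') (l mod dB')))"
    using b by (subst bip_entry_mult[of _ "dA * dA'" "dB * dB'"]) (auto simp: bip_entry_tensor intro!: sum.cong)
  also have "\<dots> = bip_entry dB (X * Y) (i div dA') (j div dB') (k div dA') (l div dB') *
      bip_entry dB' (X' * Y') (i mod dA') (j mod dB') (k mod dA') (l mod dB')"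
    unfolding sum_tensor_index[of "\<lambda>a b. bip_entry dB X (i div dA') (j div dB') a b * bip_entry dB Y a b (k div dA') (l div dB')"
        _ _ "\<lambda>a b. bip_entry dB' X' (i mod dA') (j mod dB') a b * bip_entry dB' Y' a b (k mod dA') (l mod dB')"]
      bip_entry_mult[OF assms(1,2) b'(1,3,5,7)] bip_entry_mult[OF assms(3,4) b'(2,4,6,8)] ..
  finally show "bip_entry (dB * dB') (bip_tensor dA dB (X * Y) dA' dB' (X' * Y')) i j k l =
    bip_entry (dB * dB') (bip_tensor dA dB X dA' dB' X' * bip_tensor dA dB Y dA' dB' Y') i j k l"
    using b by (simp add: bip_entry_tensor)
qed (auto intro!: mult_carrier_mat[OF bip_tensor_carrier bip_tensor_carrier])

lemma bip_tensor_tr: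
  assumes "X \<in> carrier_mat (dA * dB) (dA * dB)" "X' \<in> carrier_mat (dA' * dB') (dA' * dB')"
  shows "tr (bip_tensor dA dB X dA' dB' X') = tr X * tr X'"
proof -
  have "tr (bip_tensor dA dB X dA' dB' X') = (\<Sum>i<dA * dA'. \<Sum>j<dB * dB'.
      bip_entry dB X (i div dA') (j div dB') (i div dA') (j div dB') *
      bip_entry dB' X' (i mod dA') (j mod dB') (i mod dA') (j mod dB'))"
    using bip_tr[OF bip_tensor_carrier bip_tensor_carrier] by (auto simp: bip_entry_tensor intro!: sum.cong)
  also have "\<dots> = tr X * tr X'"
    unfolding sum_tensor_index[of "\<lambda>a b. bip_entry dB X a b a b" _ _ "\<lambda>a b. bip_entry dB' X' a b a b"]
      bip_tr[OF assms(1,1)] bip_tr[OF assms(2,2)] ..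
  finally show ?thesis .
qed

lemma bip_tensor_adjoint:
  assumes "X \<in> carrier_mat (dA * dB) (dA * dB)" "X' \<in> carrier_mat (dA' * dB') (dA' * dB')"
  shows "mat_adjoint (bip_tensor dA dB X dA' dB' X') = bip_tensor dA dB (mat_adjoint X) dA' dB' (mat_adjoint X')"
proof (rule bip_eqI[of _ "dA * dA'" "dB * dB'"])
  fix i j k l assume b: "i < dA * dA'" "j < dB * dB'" "k < dA * dA'" "l < dB * dB'"
  note b' = prod_index_bounds[OF b(1)] prod_index_bounds[OF b(2)] prod_index_bounds[OF b(3)] prod_index_bounds[OF b(4)]
  show "bip_entry (dB * dB') (mat_adjoint (bip_tensor dA dB X dA' dB' X')) i j k l
    = bip_entry (dB * dB') (bip_tensor dA dB (mat_adjoint X) dA' dB' (mat_adjoint X')) i j k l"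
    using b b' by (simp add: bip_entry_tensor bip_entry_adjoint[OF bip_tensor_carrier bip_tensor_carrier]
      bip_entry_adjoint[OF assms(1,1)] bip_entry_adjoint[OF assms(2,2)])
qed auto

lemma bip_tensor_hermitian:
  assumes "X \<in> carrier_mat (dA * dB) (dA * dB)" "X' \<in> carrier_mat (dA' * dB') (dA' * dB')"
    "hermitian X" "hermitian X'"
  shows "hermitian (bip_tensor dA dB X dA' dB' X')"
  using bip_tensor_adjoint[OF assms(1,2)] assms(3,4) unfolding hermitian_def by simp

text \<open>By the product rule a tensor product of squares is the square of the tensor product of
  the Hermitian roots.\<close>

lemma psd_bip_tensor:
  assumes "psd (dA * dB) X" "psd (dA' * dB') X'"
  shows "psd ((dA * dA') * (dB * dB')) (bip_tensor dA dB X dA' dB' X')"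
proof -
  obtain S S' where S: "psd (dA * dB) S" "S * S = X" and S': "psd (dA' * dB') S'" "S' * S' = X'"
    using exists_psd_sqrt assms by meson
  note c = psd_carrier[OF S(1)] psd_carrier[OF S'(1)]
  show ?thesis
    unfolding S(2)[symmetric] S'(2)[symmetric] bip_tensor_mult[OF c(1) c(1) c(2) c(2)]
    using bip_tensor_hermitian[OF c] psd_hermitian S(1) S'(1) by (intro psd_hermitian_square) auto
qed

text \<open>Uses \<open>2 (S \<otimes> S' \<plusminus> H \<otimes> H') = (S + H) \<otimes> (S' \<plusminus> H') + (S - H) \<otimes> (S' \<mp> H')\<close>.\<close>

lemma dominated_bip_tensor:
  assumes "dominated (dA * dB) S H" "dominated (dA' * dB') S' H'"
  shows "dominated ((dA * dA') * (dB * dB')) (bip_tensor dA dB S dA' dB' S') (bip_tensor dA dB H dA' dB' H')"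
proof -
  let ?t = "\<lambda>X X'. bip_tensor dA dB X dA' dB' X'" and ?N = "(dA * dA') * (dB * dB')"
  have c: "S \<in> carrier_mat (dA * dB) (dA * dB)" "H \<in> carrier_mat (dA * dB) (dA * dB)"
      "S' \<in> carrier_mat (dA' * dB') (dA' * dB')" "H' \<in> carrier_mat (dA' * dB') (dA' * dB')"
    and p: "psd (dA * dB) (S + H)" "psd (dA * dB) (S - H)" "psd (dA' * dB') (S' + H')" "psd (dA' * dB') (S' - H')"
    using assms unfolding dominated_def by auto
  have "?t S S' + ?t H H' = complex_of_real (1 / 2) \<cdot>\<^sub>m (?t (S + H) (S' + H') + ?t (S - H) (S' - H'))"
    (is "?l = ?r \<cdot>\<^sub>m (?p + ?q)")
  proof (rule bip_eqI[of _ "dA * dA'" "dB * dB'"])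
    fix i j k l assume b: "i < dA * dA'" "j < dB * dB'" "k < dA * dA'" "l < dB * dB'"
    note b' = prod_index_bounds[OF b(1)] prod_index_bounds[OF b(2)] prod_index_bounds[OF b(3)] prod_index_bounds[OF b(4)]
    show "bip_entry (dB * dB') ?l i j k l = bip_entry (dB * dB') (?r \<cdot>\<^sub>m (?p + ?q)) i j k l"
      unfolding bip_entry_add[OF bip_tensor_carrier bip_tensor_carrier b]
        bip_entry_smult[OF add_carrier_mat[OF bip_tensor_carrier] bip_tensor_carrier b]
        bip_entry_tensor[OF b] bip_entry_add[OF c(1,2) b'(1,3,5,7)] bip_entry_minus[OF c(1,2) b'(1,3,5,7)]
        bip_entry_add[OF c(3,4) b'(2,4,6,8)] bip_entry_minus[OF c(3,4) b'(2,4,6,8)]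
      by (simp add: field_simps)
  qed auto
  moreover have "?t S S' - ?t H H' = complex_of_real (1 / 2) \<cdot>\<^sub>m (?t (S + H) (S' - H') + ?t (S - H) (S' + H'))"
    (is "?l = ?r \<cdot>\<^sub>m (?p + ?q)")
  proof (rule bip_eqI[of _ "dA * dA'" "dB * dB'"])
    fix i j k l assume b: "i < dA * dA'" "j < dB * dB'" "k < dA * dA'" "l < dB * dB'"
    note b' = prod_index_bounds[OF b(1)] prod_index_bounds[OF b(2)] prod_index_bounds[OF b(3)] prod_index_bounds[OF b(4)]
    show "bip_entry (dB * dB') ?l i j k l = bip_entry (dB * dB') (?r \<cdot>\<^sub>m (?p + ?q)) i j k l"
      unfolding bip_entry_add[OF bip_tensor_carrier bip_tensor_carrier b] bip_entry_minus[OF bip_tensor_carrier bip_tensor_carrier b]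
        bip_entry_smult[OF add_carrier_mat[OF bip_tensor_carrier] bip_tensor_carrier b]
        bip_entry_tensor[OF b] bip_entry_add[OF c(1,2) b'(1,3,5,7)] bip_entry_minus[OF c(1,2) b'(1,3,5,7)]
        bip_entry_add[OF c(3,4) b'(2,4,6,8)] bip_entry_minus[OF c(3,4) b'(2,4,6,8)]
      by (simp add: field_simps)
  qed (auto intro!: minus_carrier_mat)
  ultimately show ?thesis
    unfolding dominated_def by (simp only: bip_tensor_carrier simp_thms)
      (intro conjI psd_smult psd_add psd_bip_tensor p, simp_all)
qed

lemma bip_tensor_one:
  "bip_tensor dA dB (c \<cdot>\<^sub>m 1\<^sub>m (dA * dB)) dA' dB' (c' \<cdot>\<^sub>m 1\<^sub>m (dA' * dB'))
    = (c * c') \<cdot>\<^sub>m 1\<^sub>m ((dA * dA') * (dB * dB'))"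
proof (rule bip_eqI[of _ "dA * dA'" "dB * dB'"])
  fix i j k l assume b: "i < dA * dA'" "j < dB * dB'" "k < dA * dA'" "l < dB * dB'"
  note b' = prod_index_bounds[OF b(1)] prod_index_bounds[OF b(2)] prod_index_bounds[OF b(3)] prod_index_bounds[OF b(4)]
  have eq: "x = y \<longleftrightarrow> x div n = y div n \<and> x mod n = y mod n" for x y n :: nat
    by (metis div_mult_mod_eq)
  show "bip_entry (dB * dB') (bip_tensor dA dB (c \<cdot>\<^sub>m 1\<^sub>m (dA * dB)) dA' dB' (c' \<cdot>\<^sub>m 1\<^sub>m (dA' * dB'))) i j k l
    = bip_entry (dB * dB') ((c * c') \<cdot>\<^sub>m 1\<^sub>m ((dA * dA') * (dB * dB'))) i j k l"
    unfolding bip_entry_tensor[OF b] bip_entry_smult[OF one_carrier_mat one_carrier_mat b]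
      bip_entry_smult[OF one_carrier_mat one_carrier_mat b'(1,3,5,7)] bip_entry_smult[OF one_carrier_mat one_carrier_mat b'(2,4,6,8)]
      bip_entry_one[OF b] bip_entry_one[OF b'(1,3,5,7)] bip_entry_one[OF b'(2,4,6,8)]
    using eq[of i k dA'] eq[of j l dB'] by auto
qed auto

section \<open>Partial transposes\<close>

lemma partial_transpose_carrier [simp]:
  "partial_transpose dA dB X \<in> carrier_mat (dA * dB) (dA * dB)"
  unfolding partial_transpose_def by simp

lemma bip_entry_partial_transpose:
  "i < dA \<Longrightarrow> j < dB \<Longrightarrow> k < dA \<Longrightarrow> l < dB \<Longrightarrow>
    bip_entry dB (partial_transpose dA dB X) i j k l = bip_entry dB X i l k j"
  unfolding partial_transpose_def by (simp add: bip_entry_bip_mat)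

lemma partial_transpose_involutive:
  "X \<in> carrier_mat (dA * dB) (dA * dB) \<Longrightarrow> partial_transpose dA dB (partial_transpose dA dB X) = X"
  by (rule bip_eqI) (auto simp: bip_entry_partial_transpose)

lemma partial_transpose_one [simp]: "partial_transpose dA dB (1\<^sub>m (dA * dB)) = 1\<^sub>m (dA * dB)"
  by (rule bip_eqI) (auto simp: bip_entry_partial_transpose bip_entry_one)

lemma partial_transpose_hermitian:
  assumes "X \<in> carrier_mat (dA * dB) (dA * dB)" "hermitian X"
  shows "hermitian (partial_transpose dA dB X)"
  unfolding hermitian_def
proof (rule bip_eqI[of _ dA dB])
  fix i j k l assume b: "i < dA" "j < dB" "k < dA" "l < dB"
  then have "bip_entry dB (mat_adjoint (partial_transpose dA dB X)) i j k l = bip_entry dB (mat_adjoint X) i l k j"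
    by (simp add: bip_entry_partial_transpose bip_entry_adjoint[OF assms(1,1)]
      bip_entry_adjoint[OF partial_transpose_carrier partial_transpose_carrier])
  then show "bip_entry dB (mat_adjoint (partial_transpose dA dB X)) i j k l = bip_entry dB (partial_transpose dA dB X) i j k l"
    using b assms(2) unfolding hermitian_def by (simp add: bip_entry_partial_transpose)
qed auto

lemma tr_partial_transpose:
  assumes "X \<in> carrier_mat (dA * dB) (dA * dB)"
  shows "tr (partial_transpose dA dB X) = tr X"
  unfolding bip_tr[OF assms assms] bip_tr[OF partial_transpose_carrier partial_transpose_carrier]
  by (auto simp: bip_entry_partial_transpose)

text \<open>Transposing both factors only exchanges the names of the two summation indices of Bob.
  Combined with involutivity, this lets a partial transpose move from one factor of a trace pairing
  to the other.\<close>

lemma tr_partial_transpose_mult: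
  assumes "X \<in> carrier_mat (dA * dB) (dA * dB)" "Y \<in> carrier_mat (dA * dB) (dA * dB)"
  shows "tr (partial_transpose dA dB X * partial_transpose dA dB Y) = tr (X * Y)"
proof -
  have "tr (partial_transpose dA dB X * partial_transpose dA dB Y) =
      (\<Sum>i<dA. \<Sum>j<dB. \<Sum>k<dA. \<Sum>l<dB. bip_entry dB X i l k j * bip_entry dB Y k j i l)"
    unfolding bip_tr_mult[OF partial_transpose_carrier partial_transpose_carrier]
    by (auto simp: bip_entry_partial_transpose intro!: sum.cong)
  also have "\<dots> = (\<Sum>i<dA. \<Sum>l<dB. \<Sum>k<dA. \<Sum>j<dB. bip_entry dB X i l k j * bip_entry dB Y k j i l)"
  proof (rule sum.cong[OF refl])
    fix i
    let ?f = "\<lambda>j k l. bip_entry dB X i l k j * bip_entry dB Y k j i l"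
    have "(\<Sum>j<dB. \<Sum>k<dA. \<Sum>l<dB. ?f j k l) = (\<Sum>k<dA. \<Sum>j<dB. \<Sum>l<dB. ?f j k l)" by (rule sum.swap)
    also have "\<dots> = (\<Sum>k<dA. \<Sum>l<dB. \<Sum>j<dB. ?f j k l)" by (intro sum.cong refl sum.swap)
    also have "\<dots> = (\<Sum>l<dB. \<Sum>k<dA. \<Sum>j<dB. ?f j k l)" by (rule sum.swap)
    finally show "(\<Sum>j<dB. \<Sum>k<dA. \<Sum>l<dB. ?f j k l) = (\<Sum>l<dB. \<Sum>k<dA. \<Sum>j<dB. ?f j k l)" .
  qed
  also have "\<dots> = tr (X * Y)" unfolding bip_tr_mult[OF assms] ..
  finally show ?thesis .
qed

text \<open>Since \<open>bip_tensor\<close> groups all of Bob's factors together, one transposition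
  of Bob's joint index transposes each factor separately. This is what reduces many copies to
  one.\<close>

lemma partial_transpose_bip_tensor:
  "partial_transpose (dA * dA') (dB * dB') (bip_tensor dA dB X dA' dB' X')
    = bip_tensor dA dB (partial_transpose dA dB X) dA' dB' (partial_transpose dA' dB' X')"
  by (rule bip_eqI[of _ "dA * dA'" "dB * dB'"])
    (auto simp: bip_entry_partial_transpose bip_entry_tensor prod_index_bounds)


section \<open>Tensor powers\<close>

lemma bip_power_carrier [simp]:
  "bip_power dA dB X n \<in> carrier_mat (dA ^ n * dB ^ n) (dA ^ n * dB ^ n)"
  using bip_tensor_carrier[of dA dB _ "dA ^ m" "dB ^ m" for m] by (cases n) auto

lemma bip_power_mult:
  assumes "X \<in> carrier_mat (dA * dB) (dA * dB)" "Y \<in> carrier_mat (dA * dB) (dA * dB)"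
  shows "bip_power dA dB (X * Y) n = bip_power dA dB X n * bip_power dA dB Y n"
  by (induction n) (simp_all add: bip_tensor_mult[OF assms])

lemma bip_power_hermitian:
  assumes "X \<in> carrier_mat (dA * dB) (dA * dB)" "hermitian X"
  shows "hermitian (bip_power dA dB X n)"
proof (induction n)
  case 0
  show ?case by (simp add: hermitian_def)
next
  case (Suc n)
  then show ?case using bip_tensor_hermitian[OF assms(1) bip_power_carrier assms(2)] by simp
qed

lemma bip_power_tr:
  assumes "X \<in> carrier_mat (dA * dB) (dA * dB)"
  shows "tr (bip_power dA dB X n) = tr X ^ n"
proof (induction n)
  case 0
  show ?case by (simp add: tr_def)
qed (simp add: bip_tensor_tr[OF assms])

lemma psd_bip_power:
  assumes "psd (dA * dB) X"
  shows "psd (dA ^ n * dB ^ n) (bip_power dA dB X n)"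
proof (induction n)
  case 0
  show ?case by (simp add: psd_one)
qed (simp add: psd_bip_tensor[OF assms])

lemma partial_transpose_bip_power:
  "partial_transpose (dA ^ n) (dB ^ n) (bip_power dA dB X n) = bip_power dA dB (partial_transpose dA dB X) n"
proof (induction n)
  case 0
  show ?case using partial_transpose_one[of 1 1] by simp
qed (simp add: partial_transpose_bip_tensor)

lemma bip_power_one:
  "bip_power dA dB (c \<cdot>\<^sub>m 1\<^sub>m (dA * dB)) n = c ^ n \<cdot>\<^sub>m 1\<^sub>m (dA ^ n * dB ^ n)"
proof (induction n)
  case 0
  show ?case by (intro eq_matI) auto
qed (simp add: bip_tensor_one)

lemma dominated_bip_power:
  assumes "dominated (dA * dB) S H"
  shows "dominated (dA ^ n * dB ^ n) (bip_power dA dB S n) (bip_power dA dB H n)"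
proof (induction n)
  case 0
  show ?case using dominated_self[OF psd_one[of 1]] by simp
qed (simp add: dominated_bip_tensor[OF assms])


section \<open>The maximally entangled state\<close>

lemma phi_vec_index: "i < 2 \<Longrightarrow> j < 2 \<Longrightarrow> phi_vec $ (i * 2 + j) = (if i = j then complex_of_real (1 / sqrt 2) else 0)"
  unfolding phi_vec_def by (auto simp: less_2_cases_iff unit_vec_def)

lemma Phi_carrier: "Phi \<in> carrier_mat (2 * 2) (2 * 2)"
  unfolding Phi_def by simp

lemma bip_entry_Phi:
  assumes "i < 2" "j < 2" "k < 2" "l < 2"
  shows "bip_entry 2 Phi i j k l = (if i = j \<and> k = l then 1 / 2 else 0)"
proof -
  have "complex_of_real (1 / sqrt 2) * complex_of_real (1 / sqrt 2) = 1 / 2"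
    unfolding of_real_mult[symmetric] by simp
  moreover have "i * 2 + j < 4" "k * 2 + l < 4" using assms by auto
  then have "bip_entry 2 Phi i j k l = phi_vec $ (i * 2 + j) * cnj (phi_vec $ (k * 2 + l))"
    unfolding bip_entry_def Phi_def by simp
  ultimately show ?thesis unfolding phi_vec_index[OF assms(1,2)] phi_vec_index[OF assms(3,4)] by auto
qed

lemma sum_2: "(\<Sum>i<(2::nat). f i) = f 0 + (f 1 :: complex)"
  by (simp add: numeral_2_eq_2)

text \<open>\<open>e\<close> lists the entries of (1 + s F) / 2 for the swap F of two qubits.
  Keeping \<open>s\<close> symbolic with \<open>s * s = 1\<close> settles the symmetric and the
  antisymmetric projection by one finite check.\<close>

lemma swap_projection:
  fixes s :: complex
  defines "e \<equiv> \<lambda>i j k l :: nat. (if i = k \<and> j = l then 1 / 2 else 0) + s * (if i = l \<and> k = j then 1 / 2 else 0)"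
  assumes "s * s = 1" "i < 2" "j < 2" "k < 2" "l < 2"
  shows "(\<Sum>a<2. \<Sum>b<2. e i j a b * e a b k l) = e i j k l"
proof -
  have "i = 0 \<or> i = 1" "j = 0 \<or> j = 1" "k = 0 \<or> k = 1" "l = 0 \<or> l = 1" using assms by auto
  then show ?thesis unfolding sum_2 e_def using assms(2)
    by (elim disjE) (simp_all add: field_simps)
qed

lemma tr_Phi: "tr Phi = 1"
  unfolding bip_tr[OF Phi_carrier Phi_carrier] by (simp add: sum_2 bip_entry_Phi)

lemma hermitian_Phi: "hermitian Phi"
  unfolding hermitian_def
  by (rule bip_eqI[of _ 2 2]) (use Phi_carrier in \<open>auto simp: bip_entry_adjoint[OF Phi_carrier Phi_carrier] bip_entry_Phi\<close>)

lemma Phi_idem: "Phi * Phi = Phi"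
proof (rule bip_eqI[of _ 2 2])
  fix i j k l :: nat assume b: "i < 2" "j < 2" "k < 2" "l < 2"
  then show "bip_entry 2 (Phi * Phi) i j k l = bip_entry 2 Phi i j k l"
    unfolding bip_entry_mult[OF Phi_carrier Phi_carrier b] by (simp add: sum_2 bip_entry_Phi)
qed (use Phi_carrier in auto)

text \<open>\<open>\<Phi>\<^bsup>T\<^sub>B\<^esup>\<close> is half the swap operator, so \<open>1/2 \<plusminus> \<Phi>\<^bsup>T\<^sub>B\<^esup>\<close> are the projections onto the
  symmetric and the antisymmetric subspace.\<close>

lemma dominated_partial_transpose_Phi:
  "dominated (2 * 2) (complex_of_real (1 / 2) \<cdot>\<^sub>m 1\<^sub>m (2 * 2)) (partial_transpose 2 2 Phi)"
proof -
  let ?c = "complex_of_real (1 / 2) \<cdot>\<^sub>m 1\<^sub>m (2 * 2)" and ?K = "partial_transpose 2 2 Phi"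
  have c: "?c \<in> carrier_mat (2 * 2) (2 * 2)" by simp
  have K: "?K \<in> carrier_mat (2 * 2) (2 * 2)" by (rule partial_transpose_carrier)
  have h: "hermitian ?c" "hermitian ?K"
    using partial_transpose_hermitian[OF Phi_carrier hermitian_Phi] by (auto simp: hermitian_def intro!: eq_matI)
  have ce: "bip_entry 2 ?c i j k l = (if i = k \<and> j = l then 1 / 2 else 0)"
    and Ke: "bip_entry 2 ?K i j k l = (if i = l \<and> k = j then 1 / 2 else 0)"
    if "i < 2" "j < 2" "k < 2" "l < 2" for i j k l
    using that bip_entry_smult[OF one_carrier_mat one_carrier_mat that] bip_entry_one[OF that]
    by (auto simp: bip_entry_partial_transpose bip_entry_Phi)
  have idem: "Q * Q = Q"
    if Q: "Q \<in> carrier_mat (2 * 2) (2 * 2)" and s: "s * s = 1"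
      and Qe: "\<And>i j k l. i < 2 \<Longrightarrow> j < 2 \<Longrightarrow> k < 2 \<Longrightarrow> l < 2 \<Longrightarrow>
        bip_entry 2 Q i j k l = (if i = k \<and> j = l then 1 / 2 else 0) + s * (if i = l \<and> k = j then 1 / 2 else 0)"
    for Q and s :: complex
  proof (rule bip_eqI[of _ 2 2])
    fix i j k l :: nat assume b: "i < 2" "j < 2" "k < 2" "l < 2"
    have "bip_entry 2 (Q * Q) i j k l = (\<Sum>a<2. \<Sum>b<2.
        ((if i = a \<and> j = b then 1 / 2 else 0) + s * (if i = b \<and> a = j then 1 / 2 else 0)) *
        ((if a = k \<and> b = l then 1 / 2 else 0) + s * (if a = l \<and> k = b then 1 / 2 else 0)))"
      unfolding bip_entry_mult[OF Q Q b] using b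
      by (intro sum.cong refl arg_cong2[where f = "(*)"] Qe) auto
    then show "bip_entry 2 (Q * Q) i j k l = bip_entry 2 Q i j k l"
      unfolding Qe[OF b] swap_projection[OF s b] .
  qed (use Q in auto)
  have "(?c + ?K) * (?c + ?K) = ?c + ?K"
  proof (rule idem[of _ 1])
    fix i j k l :: nat assume b: "i < 2" "j < 2" "k < 2" "l < 2"
    show "bip_entry 2 (?c + ?K) i j k l = (if i = k \<and> j = l then 1 / 2 else 0) + 1 * (if i = l \<and> k = j then 1 / 2 else 0)"
      unfolding bip_entry_add[OF c K b] ce[OF b] Ke[OF b] mult_1 ..
  qed (rule add_carrier_mat[OF K], simp)
  moreover have "(?c - ?K) * (?c - ?K) = ?c - ?K"
  proof (rule idem[of _ "- 1"])
    fix i j k l :: nat assume b: "i < 2" "j < 2" "k < 2" "l < 2"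
    show "bip_entry 2 (?c - ?K) i j k l = (if i = k \<and> j = l then 1 / 2 else 0) + - 1 * (if i = l \<and> k = j then 1 / 2 else 0)"
      unfolding bip_entry_minus[OF c K b] ce[OF b] Ke[OF b] by simp
  qed (rule minus_carrier_mat[OF K], simp)
  ultimately have "psd (2 * 2) (?c + ?K)" "psd (2 * 2) (?c - ?K)"
    using h by (blast intro: psd_projection hermitian_add[OF c K] hermitian_minus[OF c K] add_carrier_mat[OF K] minus_carrier_mat[OF K])+
  then show ?thesis unfolding dominated_def using c K by blast
qed

section \<open>Positive maps and PPT operations\<close>

lemma completely_positiveD:
  assumes "completely_positive d d' \<Lambda>"
  shows "X \<in> carrier_mat d d \<Longrightarrow> \<Lambda> X \<in> carrier_mat d' d'"
    "X \<in> carrier_mat d d \<Longrightarrow> Y \<in> carrier_mat d d \<Longrightarrow> \<Lambda> (X + Y) = \<Lambda> X + \<Lambda> Y"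
    "X \<in> carrier_mat d d \<Longrightarrow> \<Lambda> (c \<cdot>\<^sub>m X) = c \<cdot>\<^sub>m \<Lambda> X"
  using assms unfolding completely_positive_def linear_map_def by blast+

lemma completely_positive_minus:
  assumes "completely_positive d d' \<Lambda>" "X \<in> carrier_mat d d" "Y \<in> carrier_mat d d"
  shows "\<Lambda> (X - Y) = \<Lambda> X - \<Lambda> Y"
proof -
  note L = completely_positiveD[OF assms(1)]
  have "X - Y = X + (-1) \<cdot>\<^sub>m Y" using assms by (intro eq_matI) auto
  then have "\<Lambda> (X - Y) = \<Lambda> X + (-1) \<cdot>\<^sub>m \<Lambda> Y" using assms L by simp
  also have "\<dots> = \<Lambda> X - \<Lambda> Y" using L(1)[OF assms(2)] L(1)[OF assms(3)] by (intro eq_matI) auto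
  finally show ?thesis .
qed

text \<open>An ancilla of dimension one turns complete positivity into positivity.\<close>

lemma completely_positive_psd:
  assumes "completely_positive d d' \<Lambda>" "psd d X"
  shows "psd d' (\<Lambda> X)"
proof -
  note X = psd_carrier[OF assms(2)]
  have "mat d d (\<lambda>(r, c). bip_entry d X 0 r 0 c) = X"
    using X unfolding bip_entry_def by (intro eq_matI) auto
  then have "ampliation 1 d d' \<Lambda> X = \<Lambda> X"
    using completely_positiveD(1)[OF assms(1) X] unfolding ampliation_def bip_mat_def
    by (intro eq_matI) auto
  moreover have "psd (1 * d') (ampliation 1 d d' \<Lambda> X)"
    using assms unfolding completely_positive_def by (metis mult_1)
  ultimately show ?thesis by simp
qed

lemma dominated_completely_positive:
  assumes "completely_positive d d' \<Lambda>" "dominated d S H"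
  shows "dominated d' (\<Lambda> S) (\<Lambda> H)"
proof -
  have c: "S \<in> carrier_mat d d" "H \<in> carrier_mat d d" and p: "psd d (S + H)" "psd d (S - H)"
    using assms(2) unfolding dominated_def by auto
  show ?thesis
    using completely_positive_psd[OF assms(1) p(1)] completely_positive_psd[OF assms(1) p(2)]
      completely_positiveD[OF assms(1)] completely_positive_minus[OF assms(1)] c
    unfolding dominated_def by simp
qed

text \<open>Maps are total functions, and a map can agree with its conjugate by partial transposes
  on matrices of the right size only; complete positivity must be transferable along such
  agreement.\<close>

lemma completely_positive_cong:
  assumes "completely_positive d d' \<Lambda>" "\<And>X. X \<in> carrier_mat d d \<Longrightarrow> \<Lambda>' X = \<Lambda> X"
  shows "completely_positive d d' \<Lambda>'"
proof -
  have "ampliation k d d' \<Lambda>' = ampliation k d d' \<Lambda>" for k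
    unfolding ampliation_def using assms(2) by (simp add: fun_eq_iff)
  moreover have "linear_map d d' \<Lambda>'"
    using assms unfolding completely_positive_def linear_map_def by simp
  ultimately show ?thesis using assms(1) unfolding completely_positive_def by simp
qed

section \<open>Existence of PPT operations\<close>

lemma form_bip:
  assumes "X \<in> carrier_mat (m * n) (m * n)" "v \<in> carrier_vec (m * n)"
  shows "(X *\<^sub>v v) \<bullet>c v
    = (\<Sum>p<m. \<Sum>i<n. \<Sum>q<m. \<Sum>j<n. bip_entry n X p i q j * v $ (q * n + j) * cnj (v $ (p * n + i)))"
proof -
  have "(X *\<^sub>v v) \<bullet>c v = (\<Sum>x<m * n. (\<Sum>y<m * n. X $$ (x, y) * v $ y) * cnj (v $ x))"
    using assms by (subst cscalar_prod_sum) (auto simp: scalar_prod_def atLeast0LessThan intro!: sum.cong)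
  then show ?thesis unfolding sum_prod_index bip_entry_def by (simp add: sum_distrib_right)
qed

text \<open>The channel that discards its input and prepares the first basis state has the Kraus
  operators |0><r|. Each contributes one value of the form of \<open>X\<close>, so the ampliated
  form is a sum of nonnegative terms.\<close>

lemma completely_positive_discard_prepare:
  assumes "0 < d'"
  shows "completely_positive d d' (\<lambda>X. tr X \<cdot>\<^sub>m mat d' d' (\<lambda>(i, j). if i = 0 \<and> j = 0 then 1 else 0))"
    (is "completely_positive d d' ?\<Lambda>")
proof -
  let ?E = "mat d' d' (\<lambda>(i, j). if i = 0 \<and> j = 0 then 1 else 0) :: complex mat"
  have lin: "linear_map d d' ?\<Lambda>"
    unfolding linear_map_def by (auto simp: tr_add tr_smult algebra_simps intro!: eq_matI)
  have "psd (k * d') (ampliation k d d' ?\<Lambda> X)" if "psd (k * d) X" for k X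
    unfolding psd_def
  proof (intro conjI ballI)
    note X = psd_carrier[OF that]
    show A: "ampliation k d d' ?\<Lambda> X \<in> carrier_mat (k * d') (k * d')" unfolding ampliation_def by simp
    fix v :: "complex vec" assume v: "v \<in> carrier_vec (k * d')"
    \<comment> \<open>\<open>w r\<close> is \<open>v\<close> after the adjoint Kraus operator |r><0|
      on the second factor: the component of \<open>v\<close> at position 0 of each block is moved
      to position \<open>r\<close>.\<close>
    define w where "w r = vec (k * d) (\<lambda>x. if x mod d = r then v $ (x div d * d') else 0)" for r
    have w: "w r \<in> carrier_vec (k * d)" for r unfolding w_def by simp
    have w_index: "w r $ (q * d + t) = (if t = r then v $ (q * d') else 0)" if "q < k" "t < d" for r q t
      using that unfolding w_def by (simp add: bip_index_less)
    have "(ampliation k d d' ?\<Lambda> X *\<^sub>v v) \<bullet>c v = (\<Sum>p<k. \<Sum>i<d'. \<Sum>q<k. \<Sum>j<d'.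
        (if j = 0 then if i = 0 then tr (mat d d (\<lambda>(r, c). bip_entry d X p r q c)) * v $ (q * d') * cnj (v $ (p * d')) else 0 else 0))"
      unfolding form_bip[OF A v] unfolding ampliation_def by (intro sum.cong refl) (auto simp: bip_entry_bip_mat)
    also have "\<dots> = (\<Sum>p<k. \<Sum>i<d'. (if i = 0 then (\<Sum>q<k. tr (mat d d (\<lambda>(r, c). bip_entry d X p r q c)) * v $ (q * d') * cnj (v $ (p * d'))) else 0))"
      using assms by (intro sum.cong refl) auto
    also have "\<dots> = (\<Sum>p<k. \<Sum>q<k. tr (mat d d (\<lambda>(r, c). bip_entry d X p r q c)) * v $ (q * d') * cnj (v $ (p * d')))"
      using assms by simp
    also have "\<dots> = (\<Sum>p<k. \<Sum>q<k. \<Sum>r<d. bip_entry d X p r q r * v $ (q * d') * cnj (v $ (p * d')))"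
      by (simp add: tr_def sum_distrib_right)
    also have "\<dots> = (\<Sum>p<k. \<Sum>r<d. \<Sum>q<k. bip_entry d X p r q r * v $ (q * d') * cnj (v $ (p * d')))"
      by (intro sum.cong refl sum.swap)
    also have "\<dots> = (\<Sum>r<d. \<Sum>p<k. \<Sum>q<k. bip_entry d X p r q r * v $ (q * d') * cnj (v $ (p * d')))"
      by (rule sum.swap)
    also have "\<dots> = (\<Sum>r<d. (X *\<^sub>v w r) \<bullet>c w r)"
    proof (intro sum.cong refl)
      fix r assume "r \<in> {..<d}"
      then have r: "r < d" by simp
      have "(X *\<^sub>v w r) \<bullet>c w r = (\<Sum>p<k. \<Sum>s<d. \<Sum>q<k. \<Sum>t<d.
          (if t = r then if s = r then bip_entry d X p r q r * v $ (q * d') * cnj (v $ (p * d')) else 0 else 0))"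
        unfolding form_bip[OF X w] by (intro sum.cong refl) (auto simp: w_index)
      also have "\<dots> = (\<Sum>p<k. \<Sum>s<d. (if s = r then (\<Sum>q<k. bip_entry d X p r q r * v $ (q * d') * cnj (v $ (p * d'))) else 0))"
        using r by (intro sum.cong refl) auto
      also have "\<dots> = (\<Sum>p<k. \<Sum>q<k. bip_entry d X p r q r * v $ (q * d') * cnj (v $ (p * d')))"
        using r by simp
      finally show "(\<Sum>p<k. \<Sum>q<k. bip_entry d X p r q r * v $ (q * d') * cnj (v $ (p * d'))) = (X *\<^sub>v w r) \<bullet>c w r" ..
    qed
    also have "\<dots> \<ge> 0" using that w unfolding psd_def by (intro sum_nonneg) auto
    finally show "0 \<le> (ampliation k d d' ?\<Lambda> X *\<^sub>v v) \<bullet>c v" .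
  qed
  then show ?thesis using lin unfolding completely_positive_def by simp
qed

text \<open>A lower bound for every operation passes to the real infimum only over a nonempty set.
  The prepared product state is invariant under partial transposition, and traces are too, so
  conjugating the channel by partial transposes returns the same channel.\<close>

lemma ppt_operation_exists:
  assumes "0 < dA'" "0 < dB'"
  shows "\<exists>\<Lambda>. ppt_operation dA dB dA' dB' \<Lambda>"
proof -
  let ?E = "mat (dA' * dB') (dA' * dB') (\<lambda>(i, j). if i = 0 \<and> j = 0 then 1 else 0) :: complex mat"
  let ?\<Lambda> = "\<lambda>X. tr X \<cdot>\<^sub>m ?E"
  have cp: "completely_positive (dA * dB) (dA' * dB') ?\<Lambda>"
    using assms by (intro completely_positive_discard_prepare) simp
  have E: "tr ?E = 1" using assms unfolding tr_def by (simp add: if_distrib cong: if_cong)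
  have Ec: "?E \<in> carrier_mat (dA' * dB') (dA' * dB')" by simp
  have "bip_entry dB' ?E i j k l = (if i = 0 \<and> j = 0 \<and> k = 0 \<and> l = 0 then 1 else 0)"
    if "i < dA'" "j < dB'" "k < dA'" "l < dB'" for i j k l
    using assms that unfolding bip_entry_def by (auto simp: bip_index_less)
  then have "partial_transpose dA' dB' (c \<cdot>\<^sub>m ?E) = c \<cdot>\<^sub>m ?E" for c
    by (intro bip_eqI[of _ dA' dB']) (auto simp: bip_entry_partial_transpose bip_entry_smult[OF Ec Ec])
  then have "completely_positive (dA * dB) (dA' * dB')
      (partial_transpose dA' dB' \<circ> ?\<Lambda> \<circ> partial_transpose dA dB)"
    by (intro completely_positive_cong[OF cp]) (simp add: tr_partial_transpose)
  then show ?thesis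
    using cp E unfolding ppt_operation_def cptp_def by (intro exI[of _ ?\<Lambda>]) (simp add: tr_smult[OF Ec])
qed


section \<open>The operator norm\<close>

lemma norm_vec_sum: "v \<in> carrier_vec n \<Longrightarrow> norm_vec v = sqrt (\<Sum>i<n. (cmod (v $ i))\<^sup>2)"
  unfolding norm_vec_def by (subst cscalar_prod_self) auto

text \<open>A real supremum is an upper bound only once boundedness is known. Entries of a vector of
  norm at most 1 have modulus at most 1, so row sums of moduli give a crude bound.\<close>

lemma norm_vec_le_op_norm:
  assumes "v \<in> carrier_vec (dim_col X)" "norm_vec v \<le> 1"
  shows "norm_vec (X *\<^sub>v v) \<le> op_norm X"
  unfolding op_norm_def
proof (rule cSup_upper)
  show "norm_vec (X *\<^sub>v v) \<in> {norm_vec (X *\<^sub>v v) |v. v \<in> carrier_vec (dim_col X) \<and> norm_vec v \<le> 1}"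
    using assms by blast
  show "bdd_above {norm_vec (X *\<^sub>v v) |v. v \<in> carrier_vec (dim_col X) \<and> norm_vec v \<le> 1}"
  proof (rule bdd_aboveI)
    let ?n = "dim_row X" and ?m = "dim_col X"
    fix x assume "x \<in> {norm_vec (X *\<^sub>v v) |v. v \<in> carrier_vec ?m \<and> norm_vec v \<le> 1}"
    then obtain v where x: "x = norm_vec (X *\<^sub>v v)" and v: "v \<in> carrier_vec ?m" "norm_vec v \<le> 1" by auto
    have v1: "cmod (v $ j) \<le> 1" if "j < ?m" for j
    proof -
      have "(cmod (v $ j))\<^sup>2 \<le> (\<Sum>i<?m. (cmod (v $ i))\<^sup>2)"
        using that by (intro member_le_sum) auto
      also have "\<dots> \<le> 1" using v(2) unfolding norm_vec_sum[OF v(1)] by simp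
      finally show ?thesis by (simp add: power_le_one_iff abs_le_square_iff[of _ 1, simplified])
    qed
    have "cmod ((X *\<^sub>v v) $ i) \<le> (\<Sum>j<?m. cmod (X $$ (i, j)))" if "i < ?n" for i
    proof -
      have "(X *\<^sub>v v) $ i = (\<Sum>j<?m. X $$ (i, j) * v $ j)"
        using that v by (auto simp: scalar_prod_def atLeast0LessThan)
      also have "cmod \<dots> \<le> (\<Sum>j<?m. cmod (X $$ (i, j)))"
        using v1 by (intro sum_norm_le) (auto simp: norm_mult intro!: mult_left_le)
      finally show ?thesis .
    qed
    moreover have "X *\<^sub>v v \<in> carrier_vec ?n" by (rule carrier_vecI) simp
    ultimately show "x \<le> sqrt (\<Sum>i<?n. (\<Sum>j<?m. cmod (X $$ (i, j)))\<^sup>2)"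
      unfolding x by (subst norm_vec_sum[of _ ?n]) (auto intro!: sum_mono power_mono simp del: index_mult_mat_vec)
  qed
qed

text \<open>Testing the operator norm on the unit eigenvectors
  \<open>U *\<^sub>v unit_vec n i\<close> bounds every eigenvalue, so adding or subtracting
  \<open>Z\<close> leaves the spectrum of the scalar matrix nonnegative.\<close>

lemma dominated_op_norm:
  assumes "Z \<in> carrier_mat n n" "hermitian Z"
  shows "dominated n (complex_of_real (op_norm Z) \<cdot>\<^sub>m 1\<^sub>m n) Z"
proof -
  obtain U d where U: "unitary n U" and Z: "Z = U * real_diag n d * mat_adjoint U"
    using hermitian_spectral[OF assms] by blast
  note Uc = unitaryD[OF U]
  have d: "\<bar>d i\<bar> \<le> op_norm Z" if i: "i < n" for i
  proof -
    have iso: "norm_vec (U *\<^sub>v v) = norm_vec v" if "v \<in> carrier_vec n" for v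
    proof -
      have "(U *\<^sub>v v) \<bullet>c (U *\<^sub>v v) = v \<bullet>c ((mat_adjoint U * U) *\<^sub>v v)"
        using cscalar_prod_adjoint[OF Uc(1) that, of "U *\<^sub>v v"] assoc_mult_mat_vec[OF Uc(2,1) that] Uc(1) that by simp
      then show ?thesis unfolding norm_vec_def Uc(3) using that by simp
    qed
    let ?u = "U *\<^sub>v unit_vec n i"
    have "norm_vec (c \<cdot>\<^sub>v unit_vec n i) = cmod c" for c
    proof -
      have "(\<Sum>j<n. (cmod ((c \<cdot>\<^sub>v unit_vec n i) $ j))\<^sup>2) = (\<Sum>j<n. if j = i then (cmod c)\<^sup>2 else 0)"
        by (intro sum.cong) (auto simp: unit_vec_def)
      then show ?thesis using i by (subst norm_vec_sum[of _ n]) auto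
    qed
    note nu = this this[of 1, simplified]
    have "Z *\<^sub>v ?u = U *\<^sub>v (real_diag n d *\<^sub>v ((mat_adjoint U * U) *\<^sub>v unit_vec n i))"
      unfolding Z using Uc(1,2)
      by (simp add: assoc_mult_mat_vec[of _ n n _ n] mult_carrier_mat[of _ n n _ n] mult_mat_vec_carrier[of _ n n])
    also have "real_diag n d *\<^sub>v ((mat_adjoint U * U) *\<^sub>v unit_vec n i) = complex_of_real (d i) \<cdot>\<^sub>v unit_vec n i"
      unfolding Uc(3) one_mult_mat_vec[OF unit_vec_carrier]
    proof (rule eq_vecI)
      fix j assume "j < dim_vec (complex_of_real (d i) \<cdot>\<^sub>v unit_vec n i)"
      then have j: "j < n" by simp
      show "(real_diag n d *\<^sub>v unit_vec n i) $ j = (complex_of_real (d i) \<cdot>\<^sub>v unit_vec n i) $ j"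
        unfolding mult_mat_unit_vec_index[OF real_diag_carrier j i] using i j
        by (simp add: real_diag_def unit_vec_def)
    qed simp
    finally have "norm_vec (Z *\<^sub>v ?u) = \<bar>d i\<bar>" using iso[of "complex_of_real (d i) \<cdot>\<^sub>v unit_vec n i"] nu(1) by simp
    moreover have "norm_vec (Z *\<^sub>v ?u) \<le> op_norm Z"
      using assms(1) Uc(1) iso[of "unit_vec n i"] nu(2) by (intro norm_vec_le_op_norm) auto
    ultimately show ?thesis by simp
  qed
  have "complex_of_real (op_norm Z) \<cdot>\<^sub>m 1\<^sub>m n = U * real_diag n (\<lambda>_. op_norm Z) * mat_adjoint U"
  proof -
    have "real_diag n (\<lambda>_. op_norm Z) = complex_of_real (op_norm Z) \<cdot>\<^sub>m 1\<^sub>m n"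
      by (intro eq_matI) (auto simp: real_diag_def)
    then show ?thesis using Uc by (simp add: mult_smult_distrib[of _ n n _ n] mult_smult_assoc_mat[of _ n n _ n])
  qed
  then have "psd n (complex_of_real (op_norm Z) \<cdot>\<^sub>m 1\<^sub>m n + Z)" "psd n (complex_of_real (op_norm Z) \<cdot>\<^sub>m 1\<^sub>m n - Z)"
    using d by (auto simp: Z unitary_diag_add[OF U] unitary_diag_minus[OF U] abs_le_iff
        intro!: psd_unitary_diag[OF U]) (smt (verit) d)+
  then show ?thesis using assms(1) unfolding dominated_def by simp
qed

section \<open>Bounds on distillation and dilution errors\<close>

text \<open>The trace norm records only a real part, while the trace of a tensor power is a power of
  the full complex trace; real parts do not commute with powers, so reality is needed.\<close>

lemma psd_tr_real:
  assumes "psd n X"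
  shows "tr X = complex_of_real (Re (tr X))"
proof -
  have "X $$ (i, i) = complex_of_real (Re (X $$ (i, i)))" if "i < n" for i
    using hermitian_index[OF psd_hermitian[OF assms] psd_carrier[OF assms] that that] by (simp add: complex_eq_iff)
  then have "tr X = (\<Sum>i<n. complex_of_real (Re (X $$ (i, i))))"
    unfolding tr_def using psd_carrier[OF assms] by (intro sum.cong) auto
  then show ?thesis by simp
qed

lemma tr_one: "tr (1\<^sub>m n) = of_nat n"
  unfolding tr_def by simp

lemma partial_transpose_smult_one:
  "partial_transpose dA dB (c \<cdot>\<^sub>m 1\<^sub>m (dA * dB)) = c \<cdot>\<^sub>m 1\<^sub>m (dA * dB)"
  by (rule bip_eqI) (auto simp: bip_entry_partial_transpose bip_entry_smult[OF one_carrier_mat one_carrier_mat] bip_entry_one)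

text \<open>On partial transposes, \<open>\<Lambda>\<close> acts as the positive map \<open>T \<circ> \<Lambda> \<circ> T\<close>.\<close>

lemma ppt_operation_overlap:
  assumes "ppt_operation dA dB dA' dB' \<Lambda>"
    and X: "X \<in> carrier_mat (dA * dB) (dA * dB)" and K: "K \<in> carrier_mat (dA' * dB') (dA' * dB')"
    and S: "dominated (dA * dB) S (partial_transpose dA dB X)"
    and T: "dominated (dA' * dB') T (partial_transpose dA' dB' K)"
  shows "Re (tr (\<Lambda> X * K)) \<le> Re (tr (\<Lambda> (partial_transpose dA dB S) * partial_transpose dA' dB' T))"
proof -
  let ?N = "partial_transpose dA' dB' \<circ> \<Lambda> \<circ> partial_transpose dA dB"
  have cp: "completely_positive (dA * dB) (dA' * dB') ?N" "completely_positive (dA * dB) (dA' * dB') \<Lambda>"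
    using assms(1) unfolding ppt_operation_def cptp_def by auto
  note c = completely_positiveD(1)[OF cp(2)]
  have Tc: "T \<in> carrier_mat (dA' * dB') (dA' * dB')" using T unfolding dominated_def by simp
  have "?N (partial_transpose dA dB X) = partial_transpose dA' dB' (\<Lambda> X)"
    using X by (simp add: partial_transpose_involutive)
  then have "tr (\<Lambda> X * K) = tr (?N (partial_transpose dA dB X) * partial_transpose dA' dB' K)"
    using tr_partial_transpose_mult[OF c[OF X] K] by simp
  also have "Re \<dots> \<le> Re (tr (?N S * T))"
    using dominated_tr_mult_le[OF dominated_completely_positive[OF cp(1) S] T] by simp
  also have "tr (?N S * T) = tr (\<Lambda> (partial_transpose dA dB S) * partial_transpose dA' dB' T)"
    using tr_partial_transpose_mult[of "\<Lambda> (partial_transpose dA dB S)" dA' dB' "partial_transpose dA' dB' T"]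
      c[OF partial_transpose_carrier] Tc by (simp add: partial_transpose_involutive)
  finally show ?thesis .
qed

lemma ppt_operationD:
  assumes "ppt_operation dA dB dA' dB' \<Lambda>"
  shows "X \<in> carrier_mat (dA * dB) (dA * dB) \<Longrightarrow> \<Lambda> X \<in> carrier_mat (dA' * dB') (dA' * dB')"
    "X \<in> carrier_mat (dA * dB) (dA * dB) \<Longrightarrow> tr (\<Lambda> X) = tr X"
    "psd (dA * dB) X \<Longrightarrow> psd (dA' * dB') (\<Lambda> X)"
  using assms completely_positiveD(1) completely_positive_psd unfolding ppt_operation_def cptp_def by blast+

lemma bip_power_idem:
  assumes "X \<in> carrier_mat (dA * dB) (dA * dB)" "X * X = X"
  shows "bip_power dA dB X n * bip_power dA dB X n = bip_power dA dB X n"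
  using bip_power_mult[OF assms(1) assms(1), of n] assms(2) by simp

text \<open>Serves on both sides: it bounds the target in distillation and the input in
  dilution.\<close>

lemma dominated_Phi_power:
  "dominated (2 ^ m * 2 ^ m) (complex_of_real ((1 / 2) ^ m) \<cdot>\<^sub>m 1\<^sub>m (2 ^ m * 2 ^ m))
    (partial_transpose (2 ^ m) (2 ^ m) (bip_power 2 2 Phi m))"
  using dominated_bip_power[OF dominated_partial_transpose_Phi, of m]
  unfolding partial_transpose_bip_power bip_power_one by simp

lemma tr_mult_smult_one:
  "X \<in> carrier_mat n n \<Longrightarrow> tr (X * (c \<cdot>\<^sub>m 1\<^sub>m n)) = c * tr X"
  by (simp add: mult_smult_distrib[of _ n n _ n] tr_smult[of _ n])

text \<open>The target projection is used as a test. It has weight 1 on itself and small weight on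
  the output of \<Lambda>, so the trace norm of the difference is at least the gap.\<close>

lemma distillation_fidelity_bound:
  assumes \<rho>: "state (dA * dB) \<rho>" and \<Lambda>: "ppt_operation (dA ^ n) (dB ^ n) (2 ^ m) (2 ^ m) \<Lambda>"
  shows "1 - (1 / 2) ^ m * trace_norm (partial_transpose dA dB \<rho>) ^ n
    \<le> trace_norm (\<Lambda> (bip_power dA dB \<rho> n) - bip_power 2 2 Phi m)"
proof -
  let ?\<rho>n = "bip_power dA dB \<rho> n" and ?K = "bip_power 2 2 Phi m" and ?M = "2 ^ m * 2 ^ m :: nat"
  have \<rho>_psd: "psd (dA * dB) \<rho>" using \<rho> unfolding state_def by simp
  have H: "hermitian (partial_transpose dA dB \<rho>)"
    using partial_transpose_hermitian[OF psd_carrier[OF \<rho>_psd] psd_hermitian[OF \<rho>_psd]] .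
  obtain S where S: "psd (dA * dB) S" "psd (dA * dB) (S + partial_transpose dA dB \<rho>)"
    "psd (dA * dB) (S - partial_transpose dA dB \<rho>)" "Re (tr S) = trace_norm (partial_transpose dA dB \<rho>)"
    using trace_norm_abs[OF partial_transpose_carrier H] .
  let ?Sn = "bip_power dA dB S n" and ?c = "complex_of_real ((1 / 2) ^ m)"
  have "dominated (dA * dB) S (partial_transpose dA dB \<rho>)"
    using S psd_carrier unfolding dominated_def by simp
  then have Sn: "dominated (dA ^ n * dB ^ n) ?Sn (partial_transpose (dA ^ n) (dB ^ n) ?\<rho>n)"
    unfolding partial_transpose_bip_power by (rule dominated_bip_power)
  have trSn: "tr ?Sn = complex_of_real (trace_norm (partial_transpose dA dB \<rho>) ^ n)"
    using bip_power_tr[OF psd_carrier[OF S(1)], of n] psd_tr_real[OF S(1)] S(4) by simp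
  note L = ppt_operationD[OF \<Lambda>]
  have K: "?K \<in> carrier_mat ?M ?M" "hermitian ?K" "?K * ?K = ?K" "tr ?K = 1"
    using bip_power_hermitian[OF Phi_carrier hermitian_Phi] bip_power_idem[OF Phi_carrier Phi_idem]
      bip_power_tr[OF Phi_carrier] tr_Phi by auto
  have pSn: "partial_transpose (dA ^ n) (dB ^ n) ?Sn \<in> carrier_mat (dA ^ n * dB ^ n) (dA ^ n * dB ^ n)" by simp
  have "Re (tr (\<Lambda> ?\<rho>n * ?K)) \<le> Re (tr (\<Lambda> (partial_transpose (dA ^ n) (dB ^ n) ?Sn) * (?c \<cdot>\<^sub>m 1\<^sub>m ?M)))"
    using ppt_operation_overlap[OF \<Lambda> bip_power_carrier K(1) Sn dominated_Phi_power]
    unfolding partial_transpose_smult_one .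
  \<comment> \<open>The second factor is a multiple of the identity, so only a trace remains, and
    both \<Lambda> and the partial transpose preserve it.\<close>
  also have "tr (\<Lambda> (partial_transpose (dA ^ n) (dB ^ n) ?Sn) * (?c \<cdot>\<^sub>m 1\<^sub>m ?M)) = ?c * tr ?Sn"
    unfolding tr_mult_smult_one[OF L(1)[OF pSn]] L(2)[OF pSn] by (simp add: tr_partial_transpose)
  also have "Re \<dots> = (1 / 2) ^ m * trace_norm (partial_transpose dA dB \<rho>) ^ n"
    unfolding trSn of_real_mult[symmetric] by simp
  finally have ov: "Re (tr (\<Lambda> ?\<rho>n * ?K)) \<le> (1 / 2) ^ m * trace_norm (partial_transpose dA dB \<rho>) ^ n" .
  have \<Lambda>\<rho>: "psd ?M (\<Lambda> ?\<rho>n)" using L(3)[OF psd_bip_power[OF \<rho>_psd]] .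
  note \<Lambda>c = psd_carrier[OF \<Lambda>\<rho>]
  have "\<bar>Re (tr ((\<Lambda> ?\<rho>n - ?K) * ?K))\<bar> \<le> trace_norm (\<Lambda> ?\<rho>n - ?K)"
    using hermitian_minus[OF \<Lambda>c K(1) psd_hermitian[OF \<Lambda>\<rho>] K(2)] K
    by (intro tr_mult_le_trace_norm[of _ ?M]) (auto intro: minus_carrier_mat)
  moreover have "tr ((\<Lambda> ?\<rho>n - ?K) * ?K) = tr (\<Lambda> ?\<rho>n * ?K) - 1"
    unfolding minus_mult_distrib_mat[OF \<Lambda>c K(1,1)]
    unfolding tr_minus[OF mult_carrier_mat[OF \<Lambda>c K(1)] mult_carrier_mat[OF K(1,1)]]
    unfolding K(3,4) ..
  ultimately show ?thesis using ov by simp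
qed

text \<open>A Hermitian matrix maps every vector into the orthogonal complement of its kernel, which
  \<open>P\<close> fixes pointwise; taking adjoints of \<open>P * \<rho> = \<rho>\<close> gives the
  stated side. Hence the powers of \<open>P\<close> have weight 1 on the powers of \<rho>.\<close>

lemma support_projection_mult:
  assumes \<rho>: "psd d \<rho>" and P: "orthogonal_projection_onto d (supp \<rho>) P"
  shows "\<rho> * P = \<rho>"
proof -
  note c = psd_carrier[OF \<rho>]
  have Pc: "P \<in> carrier_mat d d" "hermitian P" "P * P = P" "(\<lambda>v. P *\<^sub>v v) ` carrier_vec d = supp \<rho>"
    using P unfolding orthogonal_projection_onto_def by auto
  have range: "P *\<^sub>v (\<rho> *\<^sub>v v) = \<rho> *\<^sub>v v" if v: "v \<in> carrier_vec d" for v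
  proof -
    have "(\<rho> *\<^sub>v v) \<bullet>c w = 0" if "w \<in> mat_kernel \<rho>" for w
    proof -
      have w: "w \<in> carrier_vec d" "\<rho> *\<^sub>v w = 0\<^sub>v d" using that mat_kernelD[OF c] by auto
      have "(\<rho> *\<^sub>v v) \<bullet>c w = v \<bullet>c (\<rho> *\<^sub>v w)"
        using cscalar_prod_adjoint[OF c v w(1)] psd_hermitian[OF \<rho>] unfolding hermitian_def by simp
      then show ?thesis using w(2) v by simp
    qed
    then have "\<rho> *\<^sub>v v \<in> supp \<rho>" using c v unfolding supp_def by auto
    then obtain u where u: "u \<in> carrier_vec d" "\<rho> *\<^sub>v v = P *\<^sub>v u" using Pc(4) by auto
    have "P *\<^sub>v (\<rho> *\<^sub>v v) = (P * P) *\<^sub>v u" using u Pc(1) by simp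
    then show ?thesis using Pc(3) u(2) by simp
  qed
  have "P * \<rho> = \<rho>"
  proof (rule eq_matI)
    fix i j assume "i < dim_row \<rho>" "j < dim_col \<rho>"
    then have ij: "i < d" "j < d" using c by auto
    have "(P * \<rho>) *\<^sub>v unit_vec d j = \<rho> *\<^sub>v unit_vec d j"
      using range[of "unit_vec d j"] Pc(1) c by simp
    then show "(P * \<rho>) $$ (i, j) = \<rho> $$ (i, j)"
      using mult_mat_unit_vec_index[OF mult_carrier_mat[OF Pc(1) c] ij] mult_mat_unit_vec_index[OF c ij] by simp
  qed (use c Pc in auto)
  then have "mat_adjoint (P * \<rho>) = mat_adjoint \<rho>" by simp
  then show ?thesis
    using mat_adjoint_mult[OF Pc(1) c] Pc(2) psd_hermitian[OF \<rho>] unfolding hermitian_def by simp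
qed

text \<open>Here the test is the tensor power of \<open>P\<close>, which has weight 1 on the target;
  the possible output of \<Lambda> has little weight on it when \<open>m\<close> is too
  small.\<close>

lemma dilution_fidelity_bound:
  assumes \<rho>: "state (dA * dB) \<rho>" and P: "orthogonal_projection_onto (dA * dB) (supp \<rho>) P"
    and Y: "hermitian Y" "dominated (dA * dB) Y (partial_transpose dA dB P)"
    and \<Lambda>: "ppt_operation (2 ^ m) (2 ^ m) (dA ^ n) (dB ^ n) \<Lambda>"
  shows "1 - 2 ^ m * op_norm (partial_transpose dA dB Y) ^ n
    \<le> trace_norm (bip_power dA dB \<rho> n - \<Lambda> (bip_power 2 2 Phi m))"
proof -
  let ?\<rho>n = "bip_power dA dB \<rho> n" and ?K = "bip_power 2 2 Phi m" and ?M = "2 ^ m * 2 ^ m :: nat"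
  let ?D = "dA ^ n * dB ^ n" and ?Pn = "bip_power dA dB P n" and ?Yn = "bip_power dA dB Y n"
  let ?c = "complex_of_real ((1 / 2) ^ m)" and ?b = "op_norm (partial_transpose dA dB Y)"
  have \<rho>_psd: "psd (dA * dB) \<rho>" and tr\<rho>: "tr \<rho> = 1" using \<rho> unfolding state_def by simp_all
  note \<rho>c = psd_carrier[OF \<rho>_psd]
  have Pc: "P \<in> carrier_mat (dA * dB) (dA * dB)" "hermitian P" "P * P = P"
    using P unfolding orthogonal_projection_onto_def by auto
  have Yc: "Y \<in> carrier_mat (dA * dB) (dA * dB)" using Y unfolding dominated_def by simp
  have Pn: "?Pn \<in> carrier_mat ?D ?D" "hermitian ?Pn" "?Pn * ?Pn = ?Pn"
    using bip_power_hermitian[OF Pc(1,2)] bip_power_idem[OF Pc(1,3)] by auto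
  have K: "psd ?M ?K"
    using psd_bip_power[of 2 2 Phi m] psd_projection[OF Phi_carrier hermitian_Phi Phi_idem] by simp
  note L = ppt_operationD[OF \<Lambda>]
  have \<Lambda>K: "psd ?D (\<Lambda> ?K)" using L(3)[OF K] .
  note \<Lambda>Kc = psd_carrier[OF \<Lambda>K]
  have tr1: "tr (?\<rho>n * ?Pn) = 1"
    unfolding bip_power_mult[OF \<rho>c Pc(1), symmetric] support_projection_mult[OF \<rho>_psd P] bip_power_tr[OF \<rho>c] tr\<rho>
    by simp
  have Yn: "dominated ?D ?Yn (partial_transpose (dA ^ n) (dB ^ n) ?Pn)"
    unfolding partial_transpose_bip_power by (rule dominated_bip_power[OF Y(2)])
  let ?one = "?c \<cdot>\<^sub>m 1\<^sub>m ?M"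
  have one: "psd ?M ?one" by (rule psd_smult[OF psd_one]) simp
  have "Re (tr (\<Lambda> ?K * ?Pn)) \<le> Re (tr (\<Lambda> ?one * partial_transpose (dA ^ n) (dB ^ n) ?Yn))"
    using ppt_operation_overlap[OF \<Lambda> bip_power_carrier Pn(1) dominated_Phi_power Yn]
    unfolding partial_transpose_smult_one .
  \<comment> \<open>A second pairing: \<open>\<Lambda> ?one\<close> is positive and so dominates
    itself, while a scalar matrix dominates the power of the partial transpose of \<open>Y\<close>,
    which may be indefinite.\<close>
  also have "\<dots> \<le> Re (tr (\<Lambda> ?one * (complex_of_real ?b ^ n \<cdot>\<^sub>m 1\<^sub>m ?D)))"
  proof -
    have "dominated (dA * dB) (complex_of_real ?b \<cdot>\<^sub>m 1\<^sub>m (dA * dB)) (partial_transpose dA dB Y)"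
      by (rule dominated_op_norm[OF partial_transpose_carrier partial_transpose_hermitian[OF Yc Y(1)]])
    from dominated_bip_power[OF this, of n]
    have "dominated ?D (complex_of_real ?b ^ n \<cdot>\<^sub>m 1\<^sub>m ?D) (partial_transpose (dA ^ n) (dB ^ n) ?Yn)"
      unfolding bip_power_one partial_transpose_bip_power .
    from dominated_tr_mult_le[OF dominated_self[OF L(3)[OF one]] this] show ?thesis by simp
  qed
  \<comment> \<open>The normalisation 2^-m against the dimension 4^m leaves the trace 2^m, which
    \<Lambda> preserves.\<close>
  also have "tr (\<Lambda> ?one * (complex_of_real ?b ^ n \<cdot>\<^sub>m 1\<^sub>m ?D)) = complex_of_real (2 ^ m * ?b ^ n)"
  proof -
    have "tr ?one = ?c * of_nat ?M" unfolding tr_smult[OF one_carrier_mat] tr_one ..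
    also have "\<dots> = complex_of_real (((1 / 2) ^ m * 2 ^ m) * 2 ^ m)" by simp
    also have "\<dots> = complex_of_real (2 ^ m)" unfolding power_mult_distrib[symmetric] by simp
    finally show ?thesis
      unfolding tr_mult_smult_one[OF L(1)[OF psd_carrier[OF one]]] L(2)[OF psd_carrier[OF one]] by simp
  qed
  finally have ov: "Re (tr (\<Lambda> ?K * ?Pn)) \<le> 2 ^ m * ?b ^ n" by simp
  have \<rho>n: "?\<rho>n \<in> carrier_mat ?D ?D" "hermitian ?\<rho>n"
    using bip_power_hermitian[OF \<rho>c psd_hermitian[OF \<rho>_psd]] by auto
  have "\<bar>Re (tr ((?\<rho>n - \<Lambda> ?K) * ?Pn))\<bar> \<le> trace_norm (?\<rho>n - \<Lambda> ?K)"
    using hermitian_minus[OF \<rho>n(1) \<Lambda>Kc \<rho>n(2) psd_hermitian[OF \<Lambda>K]] Pn \<Lambda>Kc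
    by (intro tr_mult_le_trace_norm[of _ ?D]) (auto intro: minus_carrier_mat)
  moreover have "tr ((?\<rho>n - \<Lambda> ?K) * ?Pn) = 1 - tr (\<Lambda> ?K * ?Pn)"
    unfolding minus_mult_distrib_mat[OF \<rho>n(1) \<Lambda>Kc Pn(1)]
      tr_minus[OF mult_carrier_mat[OF \<rho>n(1) Pn(1)] mult_carrier_mat[OF \<Lambda>Kc Pn(1)]] tr1 ..
  ultimately show ?thesis using ov by simp
qed

text \<open>Unit trace excludes the empty matrix. Positive dimensions are what the dilution infimum
  needs in order to have a state to prepare.\<close>

lemma state_dims_pos:
  assumes "state (dA * dB) \<rho>"
  shows "0 < dA" "0 < dB"
proof -
  have "0 < dA * dB"
  proof (rule ccontr)
    assume "\<not> 0 < dA * dB"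
    then have "tr \<rho> = 0" using assms unfolding state_def psd_def tr_def by auto
    then show False using assms unfolding state_def by simp
  qed
  then show "0 < dA" "0 < dB" by auto
qed

lemma distillation_error_bound:
  assumes "state (dA * dB) \<rho>"
  shows "1 - (1 / 2) ^ m * trace_norm (partial_transpose dA dB \<rho>) ^ n \<le> distillation_error dA dB \<rho> n m"
  unfolding distillation_error_def
  using ppt_operation_exists[of "2 ^ m" "2 ^ m" "dA ^ n" "dB ^ n"]
  by (intro cINF_greatest) (auto intro: distillation_fidelity_bound[OF assms])

lemma dilution_error_bound:
  assumes "state (dA * dB) \<rho>" "orthogonal_projection_onto (dA * dB) (supp \<rho>) P"
    "hermitian Y" "dominated (dA * dB) Y (partial_transpose dA dB P)"
  shows "1 - 2 ^ m * op_norm (partial_transpose dA dB Y) ^ n \<le> dilution_error dA dB \<rho> n m"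
  unfolding dilution_error_def
  using ppt_operation_exists[of "dA ^ n" "dB ^ n" "2 ^ m" "2 ^ m"] state_dims_pos[OF assms(1)]
  by (intro cINF_greatest) (auto intro: dilution_fidelity_bound[OF assms])


section \<open>Asymptotic rates\<close>

text \<open>For \<open>q < 1\<close> the geometric term vanishes and leaves 1 below a limit of 0.
  The constant \<open>C\<close> leaves room for the rounding of rates to whole numbers of
  pairs.\<close>

lemma one_le_geometric_rate:
  fixes f :: "nat \<Rightarrow> real"
  assumes "f \<longlonglongrightarrow> 0" "\<And>n. 1 - C * q ^ n \<le> f n" "0 \<le> q"
  shows "1 \<le> q"
proof (rule ccontr)
  assume q: "\<not> 1 \<le> q"
  have "(\<lambda>n. q ^ n) \<longlonglongrightarrow> 0" using assms(3) q by (intro LIMSEQ_power_zero) auto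
  then have "(\<lambda>n. f n + C * q ^ n) \<longlonglongrightarrow> 0 + C * 0" by (intro tendsto_add tendsto_mult tendsto_const assms(1))
  moreover have "1 \<le> f n + C * q ^ n" for n using assms(2)[of n] by simp
  ultimately show False using LIMSEQ_le_const[of _ "0 + C * 0" 1] by fastforce
qed

lemma distillable_entanglement_le:
  assumes "state (dA * dB) \<rho>" and pos: "0 < trace_norm (partial_transpose dA dB \<rho>)"
  shows "distillable_entanglement dA dB \<rho> \<le> ereal (log 2 (trace_norm (partial_transpose dA dB \<rho>)))"
  unfolding distillable_entanglement_def
proof (rule Sup_least, clarify)
  let ?a = "trace_norm (partial_transpose dA dB \<rho>)"
  fix r :: real
  assume r: "0 \<le> r" and lim: "(\<lambda>n. distillation_error dA dB \<rho> n (nat \<lfloor>r * real n\<rfloor>)) \<longlonglongrightarrow> 0"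
  have "1 - 2 * (?a / 2 powr r) ^ n \<le> distillation_error dA dB \<rho> n (nat \<lfloor>r * real n\<rfloor>)" for n
  proof -
    let ?m = "nat \<lfloor>r * real n\<rfloor>"
    \<comment> \<open>The floor loses less than one pair; this costs the factor 2 in front of the
      geometric term.\<close>
    have "(2::real) powr (r * real n) \<le> 2 powr (1 + real ?m)"
      using r by (intro powr_mono) (auto simp: of_nat_nat, linarith)
    then have "(2 powr r) ^ n \<le> 2 * 2 ^ ?m"
      by (simp add: powr_add powr_realpow powr_powr[symmetric])
    then have "(1 / 2 :: real) ^ ?m \<le> 2 / (2 powr r) ^ n"
      by (simp add: field_simps power_one_over)
    then have "(1 / 2) ^ ?m * ?a ^ n \<le> 2 * (?a / 2 powr r) ^ n"
      using pos mult_right_mono[of "(1 / 2) ^ ?m" "2 / (2 powr r) ^ n" "?a ^ n"] by (simp add: power_divide)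
    then show ?thesis using distillation_error_bound[OF assms(1), of ?m n] by linarith
  qed
  from one_le_geometric_rate[OF lim this] have "2 powr r \<le> ?a" using pos by (simp add: field_simps)
  then show "ereal r \<le> ereal (log 2 ?a)" using pos by (simp add: le_log_iff)
qed

lemma entanglement_cost_ge:
  assumes "state (dA * dB) \<rho>" "orthogonal_projection_onto (dA * dB) (supp \<rho>) P"
    "hermitian Y" "dominated (dA * dB) Y (partial_transpose dA dB P)"
    and pos: "0 < op_norm (partial_transpose dA dB Y)"
  shows "ereal (- log 2 (op_norm (partial_transpose dA dB Y))) \<le> entanglement_cost dA dB \<rho>"
  unfolding entanglement_cost_def
proof (rule Inf_greatest, clarify)
  let ?b = "op_norm (partial_transpose dA dB Y)"
  fix r :: real
  assume r: "0 \<le> r" and lim: "(\<lambda>n. dilution_error dA dB \<rho> n (nat \<lfloor>r * real n\<rfloor>)) \<longlonglongrightarrow> 0"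
  \<comment> \<open>Here rounding down works in favour of the bound, so the constant is 1, written
    out to match the shape with \<open>C\<close>.\<close>
  have "1 - 1 * (2 powr r * ?b) ^ n \<le> dilution_error dA dB \<rho> n (nat \<lfloor>r * real n\<rfloor>)" for n
  proof -
    let ?m = "nat \<lfloor>r * real n\<rfloor>"
    have "(2::real) powr real ?m \<le> 2 powr (r * real n)"
      using r by (intro powr_mono) (auto simp: of_nat_nat)
    then have "(2::real) ^ ?m \<le> (2 powr r) ^ n"
      by (simp add: powr_realpow powr_powr[symmetric])
    then have "2 ^ ?m * ?b ^ n \<le> (2 powr r * ?b) ^ n"
      using pos by (simp add: power_mult_distrib)
    then show ?thesis using dilution_error_bound[OF assms(1-4), of ?m n] by linarith
  qed
  from one_le_geometric_rate[OF lim this] have "1 / ?b \<le> 2 powr r" using pos by (simp add: field_simps)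
  then have "log 2 (1 / ?b) \<le> r" using pos by (simp add: log_le_iff)
  then show "ereal (- log 2 ?b) \<le> ereal r" using pos by (simp add: log_divide)
qed

text \<open>Pairing with the identity recovers the trace, which partial transposition preserves. The
  bound makes the logarithm of the trace norm meaningful.\<close>

lemma one_le_trace_norm_partial_transpose:
  assumes "state (dA * dB) \<rho>"
  shows "1 \<le> trace_norm (partial_transpose dA dB \<rho>)"
proof -
  have \<rho>: "psd (dA * dB) \<rho>" "tr \<rho> = 1" using assms unfolding state_def by auto
  note c = psd_carrier[OF \<rho>(1)]
  have "\<bar>Re (tr (partial_transpose dA dB \<rho> * 1\<^sub>m (dA * dB)))\<bar> \<le> trace_norm (partial_transpose dA dB \<rho>)"
    using partial_transpose_hermitian[OF c psd_hermitian[OF \<rho>(1)]]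
    by (intro tr_mult_le_trace_norm[of _ "dA * dB"]) (auto simp: hermitian_def)
  moreover have "tr (partial_transpose dA dB \<rho> * 1\<^sub>m (dA * dB)) = 1"
    using c \<rho>(2) by (simp add: tr_partial_transpose right_mult_one_mat[OF partial_transpose_carrier])
  ultimately show ?thesis by simp
qed

theorem mainTheorem9:
  fixes dA dB :: nat and \<rho> P Y :: "complex mat"
  assumes "state (dA * dB) \<rho>"
    and "orthogonal_projection_onto (dA * dB) (supp \<rho>) P"
    and "Y \<in> carrier_mat (dA * dB) (dA * dB)" and "hermitian Y"
    and "psd (dA * dB) (Y + partial_transpose dA dB P)"
    and "psd (dA * dB) (Y - partial_transpose dA dB P)"
    and "trace_norm (partial_transpose dA dB \<rho>) < inverse (op_norm (partial_transpose dA dB Y))"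
  shows "distillable_entanglement dA dB \<rho> < entanglement_cost dA dB \<rho>"
proof -
  let ?a = "trace_norm (partial_transpose dA dB \<rho>)" and ?b = "op_norm (partial_transpose dA dB Y)"
  have a: "0 < ?a" using one_le_trace_norm_partial_transpose[OF assms(1)] by simp
  \<comment> \<open>With \<open>inverse 0 = 0\<close> the hypothesis also rules out a vanishing
    norm, since its right-hand side exceeds a positive number.\<close>
  then have b: "0 < ?b" using assms(7) by (metis less_trans inverse_positive_iff_positive)
  have Y: "dominated (dA * dB) Y (partial_transpose dA dB P)"
    using assms(3,5,6) unfolding dominated_def by simp
  have "distillable_entanglement dA dB \<rho> \<le> ereal (log 2 ?a)"
    by (rule distillable_entanglement_le[OF assms(1) a])
  also have "log 2 ?a < log 2 (inverse ?b)" using a b assms(7) by simp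
  then have "ereal (log 2 ?a) < ereal (- log 2 ?b)" using b by (simp add: log_inverse)
  also have "\<dots> \<le> entanglement_cost dA dB \<rho>"
    by (rule entanglement_cost_ge[OF assms(1,2,4) Y b])
  finally show ?thesis .
qed

end
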